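(* Let $\mathbf{p}=(p_1,\dots,p_n)$ with $p_i>0$ for all $i$ and $\sum_{i=1}^n p_i=1$, let $\alpha_n>0$, and let $f_0(x)=\sum_{i=1}^n p_i\delta_{\xi_i}(x)$ be a discrete density with $n$ atoms $\xi_1,\dots,\xi_n$. Let $f$ be a "generalised Bayesian bootstrap" draw around $f_0$, that is, $f(x)=\sum_{i=1}^n w_i\delta_{\xi_i}(x)$ with random weights $\mathbf{w}=(w_1,\dots,w_n)\sim\mathrm{Dir}(\alpha_n\mathbf{p})$. Then the Kullback-Leibler divergence $\mathrm{KL}(f\,||\,f_0)=\sum_{i=1}^n w_i\log\left(\frac{w_i}{p_i}\right)$ has mean $$\mathrm{E}\{\mathrm{KL}(f\,||\,f_0)\}=\sum_{i=1}^n p_i\left\{\psi_0(\alpha_n p_i+1)-\psi_0(\alpha_n+1)\right\}-H(\mathbf{p}),$$ where $H(\mathbf{p})=\sum_{i=1}^n p_i\log p_i$, and variance $$\begin{aligned}\mathrm{Var}\{\mathrm{KL}(f\,||\,f_0)\}=&\sum_{i=1}^n\left\{\mathrm{Var}(w_i\log w_i)+(\log p_i)^2\,\mathrm{Var}(w_i)-2(\log p_i)\,\mathrm{Cov}(w_i\log w_i,w_i)\right\}\\ &+2\sum_{i<j}\left\{\mathrm{Cov}(w_i\log w_i,w_j\log w_j)+(\log p_i)(\log p_j)\,\mathrm{Cov}(w_i,w_j)-2(\log p_j)\,\mathrm{Cov}(w_i\log w_i,w_j)\right\},\end{aligned}$$ where, for all $i$ and all $j\ne i$, $$\mathrm{Var}(w_i)=\frac{p_i(1-p_i)}{\alpha_n+1},\qquad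 \mathrm{Cov}(w_i,w_j)=-\frac{p_ip_j}{\alpha_n+1},$$ $$\mathrm{Var}(w_i\log w_i)=\frac{p_i(\alpha_np_i+1)}{\alpha_n+1}\left\{\psi_1(\alpha_np_i+2)-\psi_1(\alpha_n+2)+[\psi_0(\alpha_np_i+2)-\psi_0(\alpha_n+2)]^2\right\}-p_i^2\left\{\psi_0(\alpha_np_i+1)-\psi_0(\alpha_n+1)\right\}^2,$$ $$\mathrm{Cov}(w_i\log w_i,w_i)=\frac{p_i(\alpha_np_i+1)}{\alpha_n+1}\left\{\psi_0(\alpha_np_i+2)-\psi_0(\alpha_n+2)\right\}-p_i^2\left\{\psi_0(\alpha_np_i+1)-\psi_0(\alpha_n+1)\right\},$$ $$\mathrm{Cov}(w_i\log w_i,w_j)=p_ip_j\left\{-\frac{\psi_0(\alpha_np_i+1)}{\alpha_n+1}+\psi_0(\alpha_n+1)-\frac{\alpha_n\psi_0(\alpha_n+2)}{\alpha_n+1}\right\},$$ $$\begin{aligned}\mathrm{Cov}(w_i\log w_i,w_j\log w_j)=&\frac{\alpha_np_ip_j}{\alpha_n+1}\left[\{\psi_0(\alpha_np_i+1)-\psi_0(\alpha_n+2)\}\{\psi_0(\alpha_np_j+1)-\psi_0(\alpha_n+2)\}-\psi_1(\alpha_n+2)\right]\\ &-p_ip_j\{\psi_0(\alpha_np_i+1)-\psi_0(\alpha_n+1)\}\{\psi_0(\alpha_np_j+1)-\psi_0(\alpha_n+1)\}.\end{aligned}$$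
   Context: $\mathrm{Dir}(\alpha_n\mathbf{p})$ is the Dirichlet distribution with parameter vector $(\alpha_n p_1,\dots,\alpha_n p_n)$. $\delta_{\xi}$ denotes a point mass at $\xi$. $\psi_0(x)=\frac{d}{dx}\log\Gamma(x)$ is the digamma function and $\psi_1(x)=\frac{d^2}{dx^2}\log\Gamma(x)$ the trigamma function. The sum $\sum_{i<j}$ is over pairs of indices $1\le i<j\le n$. Note the sign convention $H(\mathbf{p})=\sum_i p_i\log p_i$ (no minus sign), which is called the entropy of $\mathbf{p}$ here.
   Formalization: In the variance's sum over i<j, the printed term −2(log p_j)Cov(w_i log w_i, w_j), which makes the formula false in general, is replaced by −(log p_j)Cov(w_i log w_i, w_j) − (log p_i)Cov(w_j log w_j, w_i). *)

theory Defs
  imports "HOL-Probability.Probability"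
begin

(* (x_1, ..., x_{n-1}) |-> (x_1, ..., x_{n-1}, 1 - x_1 - ... - x_{n-1}) *)
definition simplex_point :: "nat \<Rightarrow> (nat \<Rightarrow> real) \<Rightarrow> nat \<Rightarrow> real" where
  "simplex_point n x = (\<lambda>i\<in>{1..n}. if i < n then x i else 1 - (\<Sum>k=1..<n. x k))"

definition dirichlet_density :: "nat \<Rightarrow> (nat \<Rightarrow> real) \<Rightarrow> (nat \<Rightarrow> real) \<Rightarrow> real" where
  "dirichlet_density n a y =
     (if \<forall>i\<in>{1..n}. 0 < y i
      then Gamma (\<Sum>i=1..n. a i) / (\<Prod>i=1..n. Gamma (a i)) * (\<Prod>i=1..n. y i powr (a i - 1))
      else 0)"

(* The law of (y_1, ..., y_n), y_1 + ... + y_n = 1, whose first n - 1 coordinates have the usual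
   Dirichlet density with respect to Lebesgue measure.  For n = 1 the product over the empty index
   set is a one-point probability space, and the law is the point mass at y_1 = 1. *)
definition dirichlet :: "nat \<Rightarrow> (nat \<Rightarrow> real) \<Rightarrow> (nat \<Rightarrow> real) measure" where
  "dirichlet n a =
     distr (density (\<Pi>\<^sub>M i\<in>{1..<n}. lborel)
              (\<lambda>x. ennreal (dirichlet_density n a (simplex_point n x))))
           (\<Pi>\<^sub>M i\<in>{1..n}. borel) (simplex_point n)"

definition covariance :: "'a measure \<Rightarrow> ('a \<Rightarrow> real) \<Rightarrow> ('a \<Rightarrow> real) \<Rightarrow> real" where
  "covariance M X Y =
     integral\<^sup>L M (\<lambda>\<omega>. (X \<omega> - integral\<^sup>L M X) * (Y \<omega> - integral\<^sup>L M Y))"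

definition discrete_density :: "nat \<Rightarrow> (nat \<Rightarrow> real) \<Rightarrow> (nat \<Rightarrow> 'b) \<Rightarrow> 'b \<Rightarrow> real" where
  "discrete_density n w \<xi> x = (\<Sum>i=1..n. w i * indicator {\<xi> i} x)"

(* KL(f || g) for densities with respect to counting measure; the library's KL_divergence takes the
   reference measure first. *)
definition KL_discrete :: "('b \<Rightarrow> real) \<Rightarrow> ('b \<Rightarrow> real) \<Rightarrow> real" where
  "KL_discrete f g = KL_divergence (exp 1)
     (density (count_space UNIV) (\<lambda>x. ennreal (g x)))
     (density (count_space UNIV) (\<lambda>x. ennreal (f x)))"

end

theory Submission
  imports Defs
begin

text \<open>
  Integrating out the last free coordinate of a Dirichlet density is a Beta integral and merges the
  last two parameters, so the density has total mass one by induction.  Multiplying it by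
  \<open>\<Prod>w\<^sub>i powr s\<^sub>i\<close> only shifts the parameters, which gives all real mixed moments as ratios of Gamma
  functions.  For \<open>0 < x \<le> 1\<close> the derivative of \<open>x powr s\<close> in \<open>s > 0\<close> is \<open>x powr s * ln x\<close>, with bounds
  locally uniform in \<open>s\<close>, so dominated convergence turns \<open>s\<close>-derivatives of these Gamma ratios into
  the moments that contain logarithms; digamma and trigamma enter as logarithmic derivatives of Gamma.
  The variance of the divergence is then a bilinear expansion of covariances.
\<close>

section \<open>Normalisation of the Dirichlet density\<close>

text \<open>Differentiation happens at exponents bounded away from 0: near s = 0 the factor ln x is
  unbounded, while for exponents at least c > 0 the product of the power and |ln x| stays below 1 /
  c. Only the values at 1 and 2 are needed in the end. There is one differentiation rule, of first
  order and in one exponent, but with an arbitrary bounded factor Y beside the power. Moments with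
  two logarithms therefore need no second derivative of an integral: one factor
  \<open>x * ln x\<close>, which is bounded by 1 on (0, 1], is kept as Y and the other logarithm is
  produced by differentiating. The same boundedness gives every integrability claim, independently
  of the Gamma formulas. The chart uses n - 1 free coordinates ranging over all of Euclidean space,
  so the identities behind the induction must also hold off the simplex, where both densities
  vanish.\<close>

lemma nn_integral_Beta_Ioo:
  fixes a b T :: real
  assumes "0 < a" "0 < b" "0 < T"
  shows "(\<integral>\<^sup>+ y. ennreal (y powr (a - 1) * (T - y) powr (b - 1)) * indicator {0<..<T} y \<partial>lborel) =
         ennreal (T powr (a + b - 1) * Beta a b)"
proof -
  have "((\<lambda>t. t powr (a - 1) * (1 - t) powr (b - 1)) has_integral Beta a b) {0<..<1}"
    using has_integral_Beta_real[OF assms(1,2)] by (simp add: has_integral_Icc_iff_Ioo)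
  then have unit: "(\<integral>\<^sup>+ t. ennreal (t powr (a - 1) * (1 - t) powr (b - 1)) * indicator {0<..<1} t \<partial>lborel)
      = ennreal (Beta a b)"
    by (intro nn_integral_has_integral_lebesgue') auto
  \<comment> \<open>Substitution y = T t, written \<open>0 + T * t\<close> to match the affine
    change of variables. The integrand yields the power a + b - 2 of T; the Jacobian supplies the
    missing factor T.\<close>
  have scale: "ennreal ((0 + T * t) powr (a - 1) * (T - (0 + T * t)) powr (b - 1))
        * indicator {0<..<T} (0 + T * t)
      = ennreal (T powr (a + b - 2))
        * (ennreal (t powr (a - 1) * (1 - t) powr (b - 1)) * indicator {0<..<1} t)" for t
  proof (cases "0 < t \<and> t < 1")
    case True
    then have "T - T * t = T * (1 - t)" and "a + b - 2 = (a - 1) + (b - 1)"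
      by (auto simp: algebra_simps)
    with True assms show ?thesis
      by (simp add: powr_mult mult_ac flip: ennreal_mult' powr_add)
  next
    case False
    with assms show ?thesis
      by (auto simp: indicator_def zero_less_mult_iff)
  qed
  have "(\<integral>\<^sup>+ y. ennreal (y powr (a - 1) * (T - y) powr (b - 1)) * indicator {0<..<T} y \<partial>lborel)
      = ennreal \<bar>T\<bar> * (\<integral>\<^sup>+ t. ennreal ((0 + T * t) powr (a - 1) * (T - (0 + T * t)) powr (b - 1))
        * indicator {0<..<T} (0 + T * t) \<partial>lborel)"
    using assms by (intro nn_integral_real_affine) auto
  also have "\<dots> = ennreal \<bar>T\<bar> * (ennreal (T powr (a + b - 2)) * ennreal (Beta a b))"
    unfolding scale by (subst nn_integral_cmult) (auto simp: unit)
  also have "\<dots> = ennreal (T powr (a + b - 1) * Beta a b)"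
  proof -
    have "T * T powr (a + b - 2) = T powr (a + b - 1)"
      using assms by (simp add: powr_mult_base)
    then show ?thesis
      using assms by (simp flip: ennreal_mult' mult.assoc)
  qed
  finally show ?thesis .
qed

lemma measurable_simplex_point [measurable]:
  "simplex_point n \<in> (\<Pi>\<^sub>M i\<in>{1..<n}. lborel) \<rightarrow>\<^sub>M (\<Pi>\<^sub>M i\<in>{1..n}. borel)"
proof -
  have "(\<lambda>x. if i < n then x i else 1 - (\<Sum>k=1..<n. x k)) \<in> borel_measurable (\<Pi>\<^sub>M i\<in>{1..<n}. lborel)"
    if "i \<in> {1..n}" for i :: nat
    using that by (cases "i < n") (auto intro!: borel_measurable_diff borel_measurable_sum
        measurable_component_singleton[of _ _ "\<lambda>_. lborel", simplified])
  then show ?thesis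
    unfolding simplex_point_def by (intro measurable_restrict) auto
qed

lemma borel_measurable_dirichlet_density [measurable]:
  "dirichlet_density n a \<in> borel_measurable (\<Pi>\<^sub>M i\<in>{1..n}. borel)"
proof -
  have [measurable]: "(\<lambda>y. y i) \<in> borel_measurable (\<Pi>\<^sub>M i\<in>{1..n}. borel)" if "i \<in> {1..n}" for i
    using that by (rule measurable_component_singleton)
  show ?thesis
    unfolding dirichlet_density_def by measurable
qed

lemma nn_integral_dirichlet_density_simplex_point:
  assumes "1 \<le> n" "\<And>i. i \<in> {1..n} \<Longrightarrow> 0 < a i"
  shows "(\<integral>\<^sup>+ x. ennreal (dirichlet_density n a (simplex_point n x)) \<partial>(\<Pi>\<^sub>M i\<in>{1..<n}. lborel)) = 1"
  using assms
proof (induction n arbitrary: a rule: nat_induct_at_least)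
  case base
  \<comment> \<open>Without free coordinates the integral is the value at a single point,
    \<open>Gamma (a 1) / Gamma (a 1)\<close> times a power of 1.\<close>
  then have "Gamma (a 1) \<noteq> 0"
    by (intro Gamma_nonzero) (auto elim!: nonpos_Ints_cases dest: spec[of _ 1])
  then show ?case
    by (simp add: PiM_empty nn_integral_count_space_finite dirichlet_density_def simplex_point_def)
next
  case (Suc n)
  define a' where "a' = a(n := a n + a (Suc n))"
  have pos: "0 < a i" if "1 \<le> i" "i \<le> Suc n" for i
    using Suc.prems that by auto
  interpret product_sigma_finite "\<lambda>_::nat. lborel :: real measure" ..
  have Icc: "{1..n} = insert n {1..<n}" "{1..Suc n} = insert (Suc n) (insert n {1..<n})"
    using Suc.hyps by auto
  have "Gamma (a n + a (Suc n)) > 0" "Gamma (a n) > 0" "Gamma (a (Suc n)) > 0"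
    using pos Suc.hyps by (auto intro!: Gamma_real_pos add_pos_pos)
  note Gamma_pos = this
  \<comment> \<open>Coordinates n and n + 1 share the mass T left over by the first n - 1, and T is
    exactly the last coordinate of \<open>simplex_point n x\<close>. Integrating over the split of T
    thus lands in the chart one dimension lower.\<close>
  have marginal: "(\<integral>\<^sup>+ y. ennreal (dirichlet_density (Suc n) a (simplex_point (Suc n) (x(n := y)))) \<partial>lborel)
      = ennreal (dirichlet_density n a' (simplex_point n x))" for x :: "nat \<Rightarrow> real"
  proof -
    define T where "T = 1 - (\<Sum>k=1..<n. x k)"
    define c where "c = Gamma (\<Sum>i=1..Suc n. a i) / (\<Prod>i=1..Suc n. Gamma (a i))
      * (\<Prod>i=1..<n. x i powr (a i - 1))"
    have sp': "simplex_point n x i = (if i < n then x i else T)" if "i \<in> {1..n}" for i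
      using that by (simp add: simplex_point_def T_def)
    have sp: "simplex_point (Suc n) (x(n := y)) i = (if i < n then x i else if i = n then y else T - y)"
      if "i \<in> {1..Suc n}" for i y
    proof -
      have "(\<Sum>k=1..<Suc n. (x(n := y)) k) = (\<Sum>k=1..<n. x k) + y"
        using Suc.hyps by simp
      then show ?thesis
        using that by (auto simp: simplex_point_def T_def)
    qed
    have sum': "(\<Sum>i=1..n. a' i) = (\<Sum>i=1..Suc n. a i)"
      unfolding Icc by (simp add: a'_def)
    show ?thesis
    proof (cases "(\<forall>i\<in>{1..<n}. 0 < x i) \<and> 0 < T")
      case True
      have "0 < (\<Sum>i=1..Suc n. a i)"
        by (rule sum_pos) (use pos in auto)
      then have "c \<ge> 0"
        unfolding c_def using pos True
        by (intro mult_nonneg_nonneg divide_nonneg_nonneg prod_nonneg less_imp_le[OF Gamma_real_pos]) auto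
      have "dirichlet_density (Suc n) a (simplex_point (Suc n) (x(n := y)))
          = c * (y powr (a n - 1) * (T - y) powr (a (Suc n) - 1)) * indicator {0<..<T} y" for y
      proof -
        have "(\<forall>i\<in>{1..Suc n}. 0 < simplex_point (Suc n) (x(n := y)) i)
            \<longleftrightarrow> (\<forall>i\<in>{1..Suc n}. 0 < (if i < n then x i else if i = n then y else T - y))"
          by (intro ball_cong refl) (simp only: sp)
        also have "\<dots> \<longleftrightarrow> y \<in> {0<..<T}"
          unfolding Icc using True by auto
        finally have iff: "(\<forall>i\<in>{1..Suc n}. 0 < simplex_point (Suc n) (x(n := y)) i) \<longleftrightarrow> y \<in> {0<..<T}" .
        have "(\<Prod>i=1..Suc n. simplex_point (Suc n) (x(n := y)) i powr (a i - 1))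
            = (\<Prod>i=1..Suc n. (if i < n then x i else if i = n then y else T - y) powr (a i - 1))"
          by (intro prod.cong refl) (simp only: sp)
        also have "\<dots> = y powr (a n - 1) * (T - y) powr (a (Suc n) - 1) * (\<Prod>i=1..<n. x i powr (a i - 1))"
          unfolding Icc by (auto intro!: prod.cong)
        finally show ?thesis
          unfolding dirichlet_density_def iff c_def by (simp add: indicator_def)
      qed
      then have "(\<integral>\<^sup>+ y. ennreal (dirichlet_density (Suc n) a (simplex_point (Suc n) (x(n := y)))) \<partial>lborel)
        = (\<integral>\<^sup>+ y. ennreal c * (ennreal (y powr (a n - 1) * (T - y) powr (a (Suc n) - 1)) * indicator {0<..<T} y) \<partial>lborel)"
        using \<open>c \<ge> 0\<close> by (intro nn_integral_cong) (auto simp: indicator_def ennreal_mult')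
      also have "\<dots> = ennreal (c * (T powr (a n + a (Suc n) - 1) * Beta (a n) (a (Suc n))))"
        using pos Suc.hyps True \<open>c \<ge> 0\<close>
        by (subst nn_integral_cmult, simp, subst nn_integral_Beta_Ioo) (auto simp: ennreal_mult')
      \<comment> \<open>The numerator of Beta cancels the Gamma factors of the two old parameters;
        its denominator is the Gamma factor of the merged one.\<close>
      also have "c * (T powr (a n + a (Suc n) - 1) * Beta (a n) (a (Suc n)))
          = dirichlet_density n a' (simplex_point n x)"
      proof -
        have "\<forall>i\<in>{1..n}. 0 < simplex_point n x i"
          using True by (auto simp: sp')
        moreover have "(\<Prod>i=1..n. Gamma (a' i)) = Gamma (a n + a (Suc n)) * (\<Prod>i=1..<n. Gamma (a i))"
          unfolding Icc by (auto simp: a'_def intro!: prod.cong)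
        moreover have "(\<Prod>i=1..Suc n. Gamma (a i)) = Gamma (a n) * Gamma (a (Suc n)) * (\<Prod>i=1..<n. Gamma (a i))"
          unfolding Icc by simp
        moreover have "(\<Prod>i=1..n. simplex_point n x i powr (a' i - 1))
            = T powr (a n + a (Suc n) - 1) * (\<Prod>i=1..<n. x i powr (a i - 1))"
        proof -
          have "(\<Prod>i=1..n. simplex_point n x i powr (a' i - 1))
              = (\<Prod>i=1..n. (if i < n then x i else T) powr (a' i - 1))"
            by (intro prod.cong) (auto simp: sp')
          also have "\<dots> = T powr (a n + a (Suc n) - 1) * (\<Prod>i=1..<n. x i powr (a i - 1))"
            unfolding Icc by (auto simp: a'_def intro!: prod.cong)
          finally show ?thesis .
        qed
        moreover note sum' Gamma_pos
        ultimately show ?thesis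
          by (simp add: dirichlet_density_def c_def Beta_def ac_simps del: sum.cl_ivl_Suc prod.cl_ivl_Suc)
      qed
      finally show ?thesis .
    next
      case False
      have "dirichlet_density n a' (simplex_point n x) = 0"
        using False Suc.hyps by (force simp: dirichlet_density_def sp')
      moreover have "dirichlet_density (Suc n) a (simplex_point (Suc n) (x(n := y))) = 0" for y
      proof -
        have "\<exists>i\<in>{1..Suc n}. simplex_point (Suc n) (x(n := y)) i \<le> 0"
        proof (cases "\<exists>i\<in>{1..<n}. x i \<le> 0")
          case True
          then obtain i where "i \<in> {1..<n}" "x i \<le> 0"
            by blast
          then show ?thesis
            by (intro bexI[of _ i]) (auto simp: sp)
        next
          case False
          with \<open>\<not> (_ \<and> _)\<close> have "T \<le> 0"
            by force
          \<comment> \<open>If T is not positive, y and T - y cannot both be positive; the sign of y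
            decides which of the two last coordinates is the bad one.\<close>
          then show ?thesis
            using Suc.hyps by (intro bexI[of _ "if 0 < y then Suc n else n"]) (auto simp: sp)
        qed
        then show ?thesis
          unfolding dirichlet_density_def by (auto simp: not_less)
      qed
      ultimately show ?thesis
        by simp
    qed
  qed
  have "(\<integral>\<^sup>+ x. ennreal (dirichlet_density (Suc n) a (simplex_point (Suc n) x)) \<partial>(\<Pi>\<^sub>M i\<in>{1..<Suc n}. lborel))
    = (\<integral>\<^sup>+ x. ennreal (dirichlet_density n a' (simplex_point n x)) \<partial>(\<Pi>\<^sub>M i\<in>{1..<n}. lborel))"
  proof -
    have "{1..<Suc n} = insert n {1..<n}"
      using Suc.hyps by auto
    moreover have "(\<lambda>x. ennreal (dirichlet_density (Suc n) a (simplex_point (Suc n) x)))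
        \<in> borel_measurable (\<Pi>\<^sub>M i\<in>{1..<Suc n}. lborel)"
      by measurable
    ultimately show ?thesis
      by (simp add: product_nn_integral_insert marginal)
  qed
  also have "\<dots> = 1"
    by (rule Suc.IH) (use pos Suc.hyps in \<open>auto simp: a'_def add_pos_pos\<close>)
  finally show ?case .
qed

section \<open>Differentiating real moments in the exponent\<close>

text \<open>The inequality \<open>ln y \<le> y\<close> at \<open>y = x powr - c\<close> bounds the
  logarithm by a negative power of x. Since x is at most 1, lowering the exponent from u to c only
  enlarges the product, so the bound is uniform in u. The case c = u = 1 bounds
  \<open>x * ln x\<close> by 1.\<close>

lemma powr_mult_abs_ln_le:
  fixes c u x :: real
  assumes "0 < c" "c \<le> u" "0 < x" "x \<le> 1"
  shows "x powr u * \<bar>ln x\<bar> \<le> 1 / c"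
proof -
  have "ln (x powr - c) \<le> x powr - c"
    by (rule ln_bound) (use assms in simp)
  then have "c * - ln x \<le> x powr - c"
    using assms by (simp add: ln_powr)
  then have "x powr c * (c * - ln x) \<le> x powr c * x powr - c"
    by (intro mult_left_mono) auto
  also have "\<dots> = 1"
    using assms by (simp flip: powr_add)
  finally have "c * (x powr c * \<bar>ln x\<bar>) \<le> 1"
    using assms by (simp add: mult_ac)
  then have "x powr c * \<bar>ln x\<bar> \<le> 1 / c"
    using assms by (simp add: pos_le_divide_eq mult.commute)
  moreover have "x powr u * \<bar>ln x\<bar> \<le> x powr c * \<bar>ln x\<bar>"
    using assms by (intro mult_right_mono powr_mono') auto
  ultimately show ?thesis
    by linarith
qed

lemma has_field_derivative_powr_exponent:
  fixes x :: real
  assumes "0 < x"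
  shows "((\<lambda>u. x powr u) has_field_derivative x powr z * ln x) (at z within S)"
proof -
  have "((\<lambda>u. exp (u * ln x)) has_field_derivative exp (z * ln x) * ln x) (at z within S)"
    by (auto intro!: derivative_eq_intros)
  then show ?thesis
    using assms by (simp add: powr_def)
qed

text \<open>The mean value inequality bounds all difference quotients of the power by one constant,
  which times C is the integrable majorant. Later Y is 1, a power of another coordinate, or a factor
  that already contains a logarithm.\<close>

lemma (in prob_space) has_field_derivative_expectation_powr:
  fixes X Y :: "'a \<Rightarrow> real" and C s :: real
  assumes [measurable]: "X \<in> borel_measurable M" "Y \<in> borel_measurable M"
    and X: "AE \<omega> in M. 0 < X \<omega> \<and> X \<omega> \<le> 1" and Y: "AE \<omega> in M. \<bar>Y \<omega>\<bar> \<le> C"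
    and "0 < s"
  shows "((\<lambda>u. expectation (\<lambda>\<omega>. X \<omega> powr u * Y \<omega>)) has_field_derivative
           expectation (\<lambda>\<omega>. X \<omega> powr s * ln (X \<omega>) * Y \<omega>)) (at s)"
proof -
  \<comment> \<open>Any number strictly between 0 and s would do; exponents are kept above it so
    that 1 / c bounds the derivative.\<close>
  define c where "c = s / 2"
  have "0 < c" "c < s"
    using \<open>0 < s\<close> by (auto simp: c_def)
  define F where "F u = expectation (\<lambda>\<omega>. X \<omega> powr u * Y \<omega>)" for u
  have lipschitz: "\<bar>x powr u - x powr s\<bar> \<le> 1 / c * \<bar>u - s\<bar>" if "0 < x" "x \<le> 1" "c < u" for x u :: real
  proof -
    have "norm (x powr u - x powr s) \<le> 1 / c * norm (u - s)"
    proof (rule field_differentiable_bound[of "{c<..}" _ "\<lambda>u. x powr u * ln x"])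
      show "((powr) x has_field_derivative x powr z * ln x) (at z within {c<..})" for z
        using \<open>0 < x\<close> by (rule has_field_derivative_powr_exponent)
      show "norm (x powr z * ln x) \<le> 1 / c" if "z \<in> {c<..}" for z
        using powr_mult_abs_ln_le[of c z x] that \<open>0 < c\<close> \<open>0 < x\<close> \<open>x \<le> 1\<close> by (simp add: abs_mult)
    qed (use that \<open>c < s\<close> in auto)
    then show ?thesis
      by simp
  qed
  have int: "integrable M (\<lambda>\<omega>. X \<omega> powr u * Y \<omega>)" if "0 < u" for u
  proof (rule integrable_const_bound[of _ C])
    show "AE \<omega> in M. norm (X \<omega> powr u * Y \<omega>) \<le> C"
      using X Y
    proof eventually_elim
      case (elim \<omega>)
      then have "X \<omega> powr u \<le> 1"
        using that by (intro powr_le1) auto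
      then have "X \<omega> powr u * \<bar>Y \<omega>\<bar> \<le> 1 * C"
        using elim by (intro mult_mono) auto
      then show ?case
        by (simp add: abs_mult)
    qed
  qed simp
  have "((\<lambda>u. (F u - F s) / (u - s)) \<longlongrightarrow> expectation (\<lambda>\<omega>. X \<omega> powr s * ln (X \<omega>) * Y \<omega>)) (at s within {c<..})"
    \<comment> \<open>Dominated convergence speaks of sequences, so the limit is tested along
      arbitrary sequences of exponents in \<open>{c<..} - {s}\<close>.\<close>
    unfolding tendsto_at_iff_sequentially comp_def
  proof (intro allI impI)
    fix u :: "nat \<Rightarrow> real"
    assume u: "\<forall>k. u k \<in> {c<..} - {s}" and lim: "u \<longlonglongrightarrow> s"
    define q where "q k \<omega> = (X \<omega> powr u k - X \<omega> powr s) / (u k - s) * Y \<omega>" for k \<omega>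
    have [measurable]: "q k \<in> borel_measurable M" for k
      unfolding q_def by measurable
    have "(\<lambda>k. expectation (q k)) \<longlonglongrightarrow> expectation (\<lambda>\<omega>. X \<omega> powr s * ln (X \<omega>) * Y \<omega>)"
    proof (rule integral_dominated_convergence)
      show "integrable M (\<lambda>_. 1 / c * C)"
        by simp
      show "AE \<omega> in M. (\<lambda>k. q k \<omega>) \<longlonglongrightarrow> X \<omega> powr s * ln (X \<omega>) * Y \<omega>"
        using X
      proof eventually_elim
        case (elim \<omega>)
        then have "((powr) (X \<omega>) has_field_derivative X \<omega> powr s * ln (X \<omega>)) (at s)"
          by (intro has_field_derivative_powr_exponent) simp
        then have "(\<lambda>k. (X \<omega> powr u k - X \<omega> powr s) / (u k - s)) \<longlonglongrightarrow> X \<omega> powr s * ln (X \<omega>)"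
          using u lim unfolding has_field_derivative_iff tendsto_at_iff_sequentially comp_def by auto
        then show ?case
          unfolding q_def by (intro tendsto_mult tendsto_const)
      qed
      show "AE \<omega> in M. norm (q k \<omega>) \<le> 1 / c * C" for k
        using X Y
      proof eventually_elim
        case (elim \<omega>)
        have "\<bar>(X \<omega> powr u k - X \<omega> powr s) / (u k - s)\<bar> \<le> 1 / c"
          using lipschitz[of "X \<omega>" "u k"] elim u by (auto simp: abs_divide divide_le_eq)
        then show ?case
          unfolding q_def real_norm_def abs_mult using elim \<open>0 < c\<close> by (intro mult_mono) auto
      qed
    qed auto
    moreover have "expectation (q k) = (F (u k) - F s) / (u k - s)" for k
    proof -
      have "0 < u k"
        using u \<open>0 < c\<close> by (metis DiffD1 greaterThan_iff order_less_trans)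
      then have "F (u k) - F s = expectation (\<lambda>\<omega>. X \<omega> powr u k * Y \<omega> - X \<omega> powr s * Y \<omega>)"
        unfolding F_def using \<open>0 < s\<close> by (intro Bochner_Integration.integral_diff[symmetric] int)
      moreover have "q k = (\<lambda>\<omega>. (X \<omega> powr u k * Y \<omega> - X \<omega> powr s * Y \<omega>) / (u k - s))"
        by (simp add: q_def left_diff_distrib fun_eq_iff)
      ultimately show ?thesis
        by (simp only: integral_divide_zero)
    qed
    ultimately show "(\<lambda>k. (F (u k) - F s) / (u k - s)) \<longlonglongrightarrow> expectation (\<lambda>\<omega>. X \<omega> powr s * ln (X \<omega>) * Y \<omega>)"
      by simp
  qed
  then have "(F has_field_derivative expectation (\<lambda>\<omega>. X \<omega> powr s * ln (X \<omega>) * Y \<omega>)) (at s within {c<..})"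
    unfolding has_field_derivative_iff .
  then show ?thesis
    using at_within_open[of s "{c<..}"] \<open>c < s\<close> by (simp add: F_def[abs_def])
qed

text \<open>Uniqueness of derivatives: F agrees with the moment function on the open half-line
  around s. A closed form for power moments thus becomes one for logarithmic moments without
  computing another integral.\<close>

lemma (in prob_space) expectation_powr_ln_eqI:
  fixes X Y :: "'a \<Rightarrow> real" and C s :: real
  assumes "X \<in> borel_measurable M" "Y \<in> borel_measurable M"
    and "AE \<omega> in M. 0 < X \<omega> \<and> X \<omega> \<le> 1" "AE \<omega> in M. \<bar>Y \<omega>\<bar> \<le> C"
    and "0 < s"
    and F: "\<And>u. 0 < u \<Longrightarrow> expectation (\<lambda>\<omega>. X \<omega> powr u * Y \<omega>) = F u"
    and D: "(F has_field_derivative D) (at s)"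
  shows "expectation (\<lambda>\<omega>. X \<omega> powr s * ln (X \<omega>) * Y \<omega>) = D"
proof (rule DERIV_unique[OF _ D])
  show "(F has_field_derivative expectation (\<lambda>\<omega>. X \<omega> powr s * ln (X \<omega>) * Y \<omega>)) (at s)"
    by (rule has_field_derivative_transform_within_open
        [OF has_field_derivative_expectation_powr[OF assms(1-5)], where S = "{0<..}"])
      (use F \<open>0 < s\<close> in auto)
qed

section \<open>Covariance\<close>

lemma (in prob_space) integrable_of_abs_le_one:
  fixes f :: "'a \<Rightarrow> real"
  assumes "f \<in> borel_measurable M" "AE \<omega> in M. \<bar>f \<omega>\<bar> \<le> 1"
  shows "integrable M f"
  using assms by (intro integrable_const_bound[of _ 1]) auto

lemma (in prob_space) integrable_mult_of_abs_le_one: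
  fixes f g :: "'a \<Rightarrow> real"
  assumes [measurable]: "f \<in> borel_measurable M" "g \<in> borel_measurable M"
    and "AE \<omega> in M. \<bar>f \<omega>\<bar> \<le> 1" "AE \<omega> in M. \<bar>g \<omega>\<bar> \<le> 1"
  shows "integrable M (\<lambda>\<omega>. f \<omega> * g \<omega>)"
proof (rule integrable_of_abs_le_one)
  show "AE \<omega> in M. \<bar>f \<omega> * g \<omega>\<bar> \<le> 1"
    using assms(3,4)
  proof eventually_elim
    case (elim \<omega>)
    then show ?case
      using mult_mono[of "\<bar>f \<omega>\<bar>" 1 "\<bar>g \<omega>\<bar>" 1] by (simp add: abs_mult)
  qed
qed simp

lemma (in prob_space) covariance_eq:
  fixes X Y :: "'a \<Rightarrow> real"
  assumes "integrable M X" "integrable M Y" "integrable M (\<lambda>\<omega>. X \<omega> * Y \<omega>)"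
  shows "covariance M X Y = expectation (\<lambda>\<omega>. X \<omega> * Y \<omega>) - expectation X * expectation Y"
proof -
  have "covariance M X Y = expectation (\<lambda>\<omega>. X \<omega> * Y \<omega> - expectation Y * X \<omega> - expectation X * Y \<omega>
      + expectation X * expectation Y)"
    unfolding covariance_def by (intro Bochner_Integration.integral_cong) (auto simp: algebra_simps)
  also have "\<dots> = expectation (\<lambda>\<omega>. X \<omega> * Y \<omega>) - expectation X * expectation Y"
    using assms by (simp add: prob_space)
  finally show ?thesis .
qed

lemma variance_eq_covariance:
  "integral\<^sup>L M (\<lambda>\<omega>. (X \<omega> - integral\<^sup>L M X)\<^sup>2) = covariance M X X"
  by (simp add: covariance_def power2_eq_square)

lemma covariance_commute: "covariance M X Y = covariance M Y X"
  by (simp add: covariance_def mult.commute)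

text \<open>Shaped for the summands \<open>L i - ln (p i) * W i\<close> of the divergence.\<close>

lemma (in prob_space) covariance_diff_scaled:
  fixes X Y U V :: "'a \<Rightarrow> real" and b c :: real
  assumes [simp]: "integrable M X" "integrable M Y" "integrable M U" "integrable M V"
    "integrable M (\<lambda>\<omega>. X \<omega> * U \<omega>)" "integrable M (\<lambda>\<omega>. X \<omega> * V \<omega>)"
    "integrable M (\<lambda>\<omega>. Y \<omega> * U \<omega>)" "integrable M (\<lambda>\<omega>. Y \<omega> * V \<omega>)"
  shows "covariance M (\<lambda>\<omega>. X \<omega> - b * Y \<omega>) (\<lambda>\<omega>. U \<omega> - c * V \<omega>)
    = covariance M X U - c * covariance M X V - b * covariance M Y U + b * c * covariance M Y V"
proof -
  have expand: "(\<lambda>\<omega>. (X \<omega> - b * Y \<omega>) * (U \<omega> - c * V \<omega>))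
      = (\<lambda>\<omega>. X \<omega> * U \<omega> - c * (X \<omega> * V \<omega>) - b * (Y \<omega> * U \<omega>) + b * c * (Y \<omega> * V \<omega>))"
    by (auto simp: algebra_simps)
  have "integrable M (\<lambda>\<omega>. (X \<omega> - b * Y \<omega>) * (U \<omega> - c * V \<omega>))"
    unfolding expand by simp
  then have "covariance M (\<lambda>\<omega>. X \<omega> - b * Y \<omega>) (\<lambda>\<omega>. U \<omega> - c * V \<omega>)
      = expectation (\<lambda>\<omega>. X \<omega> * U \<omega> - c * (X \<omega> * V \<omega>) - b * (Y \<omega> * U \<omega>) + b * c * (Y \<omega> * V \<omega>))
        - (expectation X - b * expectation Y) * (expectation U - c * expectation V)"
    by (subst covariance_eq) (auto simp: expand)
  also have "\<dots> = expectation (\<lambda>\<omega>. X \<omega> * U \<omega>) - c * expectation (\<lambda>\<omega>. X \<omega> * V \<omega>)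
      - b * expectation (\<lambda>\<omega>. Y \<omega> * U \<omega>) + b * c * expectation (\<lambda>\<omega>. Y \<omega> * V \<omega>)
      - (expectation X - b * expectation Y) * (expectation U - c * expectation V)"
    by simp
  finally show ?thesis
    unfolding covariance_eq[OF assms(1,3,5)] covariance_eq[OF assms(1,4,6)]
      covariance_eq[OF assms(2,3,7)] covariance_eq[OF assms(2,4,8)]
    by (simp add: algebra_simps)
qed

lemma (in prob_space) variance_sum_eq_covariance:
  fixes X :: "'b \<Rightarrow> 'a \<Rightarrow> real"
  assumes int: "\<And>i. i \<in> I \<Longrightarrow> integrable M (X i)"
    and int2: "\<And>i j. i \<in> I \<Longrightarrow> j \<in> I \<Longrightarrow> integrable M (\<lambda>\<omega>. X i \<omega> * X j \<omega>)"
  shows "variance (\<lambda>\<omega>. \<Sum>i\<in>I. X i \<omega>) = (\<Sum>i\<in>I. \<Sum>j\<in>I. covariance M (X i) (X j))"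
proof -
  have "integrable M (\<lambda>\<omega>. (X i \<omega> - expectation (X i)) * (X j \<omega> - expectation (X j)))"
    if "i \<in> I" "j \<in> I" for i j
    unfolding left_diff_distrib right_diff_distrib using int int2 that by simp
  moreover have "((\<Sum>i\<in>I. X i \<omega>) - expectation (\<lambda>\<omega>. \<Sum>i\<in>I. X i \<omega>))\<^sup>2
      = (\<Sum>i\<in>I. \<Sum>j\<in>I. (X i \<omega> - expectation (X i)) * (X j \<omega> - expectation (X j)))" for \<omega>
    using int by (simp add: power2_eq_square sum_product flip: sum_subtractf)
  ultimately show ?thesis
    by (simp add: covariance_def)
qed

lemma sum_symmetric_eq_diagonal_plus_upper:
  fixes c :: "nat \<Rightarrow> nat \<Rightarrow> real"
  assumes "\<And>i j. c i j = c j i"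
  shows "(\<Sum>i=1..n. \<Sum>j=1..n. c i j) = (\<Sum>i=1..n. c i i) + 2 * (\<Sum>i=1..n. \<Sum>j=i+1..n. c i j)"
proof (induction n)
  case (Suc n)
  \<comment> \<open>The new row i = n + 1 has an empty range, so the upper triangle gains only a
    column. The full square gains that column, its mirror image as a row, and the corner.\<close>
  have "(\<Sum>i=1..Suc n. \<Sum>j=i+1..Suc n. c i j) = (\<Sum>i=1..n. (\<Sum>j=i+1..n. c i j) + c i (Suc n))"
    by (simp add: sum.cl_ivl_Suc)
  moreover have "(\<Sum>i=1..Suc n. \<Sum>j=1..Suc n. c i j)
      = (\<Sum>i=1..n. \<Sum>j=1..n. c i j) + 2 * (\<Sum>i=1..n. c i (Suc n)) + c (Suc n) (Suc n)"
  proof -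
    have "(\<Sum>j=1..n. c (Suc n) j) = (\<Sum>i=1..n. c i (Suc n))"
      by (intro sum.cong refl assms)
    then show ?thesis
      by (simp add: sum.distrib)
  qed
  ultimately show ?case
    using Suc.IH by (simp add: sum.distrib)
qed simp

section \<open>Kullback-Leibler divergence of discrete densities\<close>

text \<open>
  Negative weights are truncated to zero by \<open>ennreal\<close>.  Covering them makes the divergence a measurable
  function of the weights everywhere, not only on the simplex.
\<close>

lemma KL_discrete_discrete_density:
  fixes \<xi> :: "nat \<Rightarrow> 'a"
  assumes inj: "inj_on \<xi> {1..n}"
    and p: "\<And>i. i \<in> {1..n} \<Longrightarrow> 0 < p i"
  shows "KL_discrete (discrete_density n v \<xi>) (discrete_density n p \<xi>) = (\<Sum>i=1..n. max 0 (v i) * ln (max 0 (v i) / p i))"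
proof -
  \<comment> \<open>Injectivity leaves a single nonzero indicator at each atom.\<close>
  have atom: "discrete_density n q \<xi> (\<xi> i) = q i" if "i \<in> {1..n}" for q i
  proof -
    have "discrete_density n q \<xi> (\<xi> i) = (\<Sum>j=1..n. if j = i then q j else 0)"
      unfolding discrete_density_def using that by (intro sum.cong) (auto simp: inj_on_eq_iff[OF inj])
    then show ?thesis
      using that by simp
  qed
  have off: "discrete_density n q \<xi> x = 0" if "x \<notin> \<xi> ` {1..n}" for q x
    unfolding discrete_density_def using that by (intro sum.neutral) (auto simp: indicator_def)
  define f where "f x = max 0 (discrete_density n v \<xi> x)" for x
  define g where "g = discrete_density n p \<xi>"
  define G where "G = density (count_space UNIV) (\<lambda>x. ennreal (g x))"
  have fg: "0 \<le> f x" "0 \<le> g x" for x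
    using p by (force simp: f_def g_def discrete_density_def less_imp_le intro!: sum_nonneg)+
  have supp: "f x = 0" "g x = 0" if "x \<notin> \<xi> ` {1..n}" for x
    using that by (auto simp: f_def g_def off)
  \<comment> \<open>Counting measure on an uncountable type is not sigma-finite, but G lives on
    finitely many atoms. Its finiteness is what makes \<open>KL_density\<close> applicable.\<close>
  interpret finite_measure G
  proof
    have "emeasure G (space G) = (\<Sum>x\<in>\<xi> ` {1..n}. ennreal (g x))"
      unfolding G_def using supp by (simp add: emeasure_density) (intro nn_integral_count_space', auto)
    then show "emeasure G (space G) \<noteq> \<infinity>"
      by simp
  qed
  have "density (count_space UNIV) (\<lambda>x. ennreal (f x)) = density G (\<lambda>x. ennreal (f x / g x))"
  proof -
    \<comment> \<open>At an atom g is some \<open>p i > 0\<close>; elsewhere f and g both vanish and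
      the quotient is 0 by convention.\<close>
    have "g x * (f x / g x) = f x" for x
    proof (cases "x \<in> \<xi> ` {1..n}")
      case True
      then obtain i where "i \<in> {1..n}" "x = \<xi> i"
        by blast
      then show ?thesis
        using p[of i] by (simp add: g_def atom)
    qed (simp add: supp)
    then show ?thesis
      unfolding G_def using fg by (subst density_density_eq) (simp_all flip: ennreal_mult')
  qed
  then have "KL_discrete f g = KL_divergence (exp 1) G (density G (\<lambda>x. ennreal (f x / g x)))"
    by (simp add: KL_discrete_def G_def)
  also have "\<dots> = (\<integral>x. f x / g x * ln (f x / g x) \<partial>G)"
  proof (subst KL_density)
    show "(\<lambda>x. f x / g x) \<in> borel_measurable G"
      by (simp add: G_def)
  qed (use fg in \<open>auto simp: log_def\<close>)
  also have "\<dots> = (\<integral>x. g x * (f x / g x * ln (f x / g x)) \<partial>count_space UNIV)"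
    unfolding G_def using fg by (subst integral_density) auto
  also have "\<dots> = (\<Sum>x\<in>\<xi> ` {1..n}. g x * (f x / g x * ln (f x / g x)))"
  proof -
    have sum: "(\<integral>x. h x \<partial>count_space UNIV) = (\<Sum>x\<in>S. h x)"
      if "finite S" "\<And>x. x \<notin> S \<Longrightarrow> h x = 0" for h :: "'a \<Rightarrow> real" and S
    proof -
      have supp: "{x. h x \<noteq> 0} \<subseteq> S"
        using that(2) by auto
      then have "finite {x. h x \<noteq> 0}"
        using that(1) by (rule finite_subset)
      then have "(\<integral>x. h x \<partial>count_space UNIV) = (\<Sum>x | h x \<noteq> 0. h x)"
        by (simp add: lebesgue_integral_count_space_finite_support)
      also have "\<dots> = (\<Sum>x\<in>S. h x)"
        using that(1) supp by (intro sum.mono_neutral_left) auto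
      finally show ?thesis .
    qed
    show ?thesis
      by (rule sum) (simp_all add: supp)
  qed
  also have "\<dots> = (\<Sum>i=1..n. g (\<xi> i) * (f (\<xi> i) / g (\<xi> i) * ln (f (\<xi> i) / g (\<xi> i))))"
    using inj by (subst sum.reindex) auto
  also have "\<dots> = (\<Sum>i=1..n. max 0 (v i) * ln (max 0 (v i) / p i))"
  proof (intro sum.cong refl)
    fix i assume "i \<in> {1..n}"
    then show "g (\<xi> i) * (f (\<xi> i) / g (\<xi> i) * ln (f (\<xi> i) / g (\<xi> i))) = max 0 (v i) * ln (max 0 (v i) / p i)"
      using p[of i] by (simp add: f_def g_def atom)
  qed
  finally show ?thesis
    by (simp add: f_def[abs_def] g_def KL_discrete_def)
qed

section \<open>Moments of a Dirichlet vector\<close>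

lemma not_nonpos_Ints_of_pos: "0 < x \<Longrightarrow> x \<notin> \<int>\<^sub>\<le>\<^sub>0" for x :: real
  by (auto elim!: nonpos_Ints_cases)

lemma Gamma_plus_one_of_pos: "0 < x \<Longrightarrow> Gamma (x + 1) = x * Gamma x" for x :: real
  by (intro Gamma_plus1 not_nonpos_Ints_of_pos)

lemma Gamma_nonzero_of_pos: "0 < x \<Longrightarrow> Gamma x \<noteq> 0" for x :: real
  by (metis Gamma_real_pos less_irrefl)

lemma Gamma_plus_two_of_pos: "0 < x \<Longrightarrow> Gamma (x + 2) = x * (x + 1) * Gamma x" for x :: real
  using Gamma_plus_one_of_pos[of "x + 1"] Gamma_plus_one_of_pos[of x] by (simp add: algebra_simps)

lemma has_field_derivative_Gamma_ratio:
  fixes a b u :: real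
  assumes "0 < a + u" "0 < b + u"
  shows "((\<lambda>u. Gamma (a + u) / Gamma (b + u)) has_field_derivative
    Gamma (a + u) / Gamma (b + u) * (Digamma (a + u) - Digamma (b + u))) (at u)"
  using Gamma_real_pos[OF assms(1)] Gamma_real_pos[OF assms(2)] not_nonpos_Ints_of_pos[OF assms(1)]
    not_nonpos_Ints_of_pos[OF assms(2)]
  by (auto intro!: derivative_eq_intros simp: field_simps)

locale dirichlet_random_vector = prob_space M for M :: "'a measure" +
  fixes n :: nat and a :: "nat \<Rightarrow> real" and w :: "'a \<Rightarrow> nat \<Rightarrow> real"
  assumes n_pos: "1 \<le> n"
    and a_pos: "\<And>i. i \<in> {1..n} \<Longrightarrow> 0 < a i"
    and measurable_w: "w \<in> M \<rightarrow>\<^sub>M (\<Pi>\<^sub>M i\<in>{1..n}. borel)"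
    and distr_w: "distr M (\<Pi>\<^sub>M i\<in>{1..n}. borel) w = dirichlet n a"
begin

text \<open>Total concentration; it becomes \<open>\<alpha>\<close> when
  \<open>a i = \<alpha> * p i\<close>, because the p i sum to 1.\<close>

definition A :: real where "A = (\<Sum>i=1..n. a i)"

lemma A_pos: "0 < A"
  unfolding A_def using n_pos a_pos by (intro sum_pos) auto

lemma borel_measurable_w [measurable]: "i \<in> {1..n} \<Longrightarrow> (\<lambda>\<omega>. w \<omega> i) \<in> borel_measurable M"
  using measurable_compose[OF measurable_w measurable_component_singleton[of i "{1..n}" "\<lambda>_. borel"]]
  by simp

lemma nn_integral_w:
  assumes [measurable]: "f \<in> borel_measurable (\<Pi>\<^sub>M i\<in>{1..n}. borel)"
  shows "(\<integral>\<^sup>+ \<omega>. f (w \<omega>) \<partial>M) = (\<integral>\<^sup>+ x. ennreal (dirichlet_density n a (simplex_point n x)) * f (simplex_point n x)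
           \<partial>(\<Pi>\<^sub>M i\<in>{1..<n}. lborel))"
proof -
  have "(\<integral>\<^sup>+ \<omega>. f (w \<omega>) \<partial>M) = (\<integral>\<^sup>+ y. f y \<partial>dirichlet n a)"
    unfolding distr_w[symmetric] using measurable_w assms by (subst nn_integral_distr) auto
  also have "\<dots> = (\<integral>\<^sup>+ x. f (simplex_point n x)
      \<partial>density (\<Pi>\<^sub>M i\<in>{1..<n}. lborel) (\<lambda>x. ennreal (dirichlet_density n a (simplex_point n x))))"
    unfolding dirichlet_def by (rule nn_integral_distr; measurable)
  finally show ?thesis
    by (subst (asm) nn_integral_density; measurable)
qed

text \<open>The coordinates of \<open>simplex_point\<close> sum to 1 at every point of the chart,
  and the density is 0 unless all of them are positive. So the property holds wherever the density
  is nonzero, and it is carried along the two image measures.\<close>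

lemma AE_w: "AE \<omega> in M. (\<forall>i\<in>{1..n}. 0 < w \<omega> i) \<and> (\<Sum>i=1..n. w \<omega> i) = 1"
proof -
  have [measurable]: "(\<lambda>y. y i) \<in> borel_measurable (\<Pi>\<^sub>M i\<in>{1..n}. borel)" if "i \<in> {1..n}" for i
    using that by (rule measurable_component_singleton)
  define P where "P y \<longleftrightarrow> (\<forall>i\<in>{1..n}. (0::real) < y i) \<and> (\<Sum>i=1..n. y i) = 1" for y
  have [measurable]: "Measurable.pred (\<Pi>\<^sub>M i\<in>{1..n}. borel) P"
    unfolding P_def by measurable
  have density: "(\<lambda>x. ennreal (dirichlet_density n a (simplex_point n x))) \<in> borel_measurable (\<Pi>\<^sub>M i\<in>{1..<n}. lborel)"
    by measurable
  have "(\<Sum>i=1..n. simplex_point n x i) = 1" for x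
  proof -
    have "{1..n} = insert n {1..<n}"
      using n_pos by auto
    then show ?thesis
      by (simp add: simplex_point_def)
  qed
  then have "P (simplex_point n x)" if "0 < ennreal (dirichlet_density n a (simplex_point n x))" for x
    using that by (cases "\<forall>i\<in>{1..n}. 0 < simplex_point n x i") (simp_all only: P_def dirichlet_density_def if_False ennreal_0 less_irrefl)
  then have "AE x in density (\<Pi>\<^sub>M i\<in>{1..<n}. lborel) (\<lambda>x. ennreal (dirichlet_density n a (simplex_point n x))).
      P (simplex_point n x)"
    unfolding AE_density[OF density] by simp
  then have "AE y in dirichlet n a. P y"
    unfolding dirichlet_def by (subst AE_distr_iff; measurable)
  then have "AE y in distr M (\<Pi>\<^sub>M i\<in>{1..n}. borel) w. P y"
    by (simp only: distr_w)
  then show ?thesis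
    using measurable_w by (subst (asm) AE_distr_iff) (auto simp: P_def)
qed

lemma AE_w_unit:
  assumes "i \<in> {1..n}"
  shows "AE \<omega> in M. 0 < w \<omega> i \<and> w \<omega> i \<le> 1"
  using AE_w
proof eventually_elim
  case (elim \<omega>)
  then have "w \<omega> i \<le> (\<Sum>i=1..n. w \<omega> i)"
    using assms by (intro member_le_sum) (auto intro: less_imp_le)
  then show ?case
    using elim assms by auto
qed

lemma expectation_prod_powr:
  assumes "I \<subseteq> {1..n}" and s: "\<And>i. i \<in> I \<Longrightarrow> 0 \<le> s i"
  shows "expectation (\<lambda>\<omega>. \<Prod>i\<in>I. w \<omega> i powr s i)
    = Gamma A / Gamma (A + (\<Sum>i\<in>I. s i)) * (\<Prod>i\<in>I. Gamma (a i + s i) / Gamma (a i))"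
proof -
  have [measurable]: "(\<lambda>y. y i) \<in> borel_measurable (\<Pi>\<^sub>M i\<in>{1..n}. borel)" if "i \<in> {1..n}" for i
    using that by (rule measurable_component_singleton)
  \<comment> \<open>Exponents are extended by 0 so that the product meets every factor of the
    density. As \<open>0 powr 0 = 0\<close>, the two products agree only where the coordinates are
    nonzero, hence almost surely.\<close>
  define S where "S i = (if i \<in> I then s i else 0)" for i
  define b where "b i = a i + S i" for i
  have b_pos: "0 < b i" if "i \<in> {1..n}" for i
    using a_pos[OF that] s by (auto simp: b_def S_def add_pos_nonneg)
  \<comment> \<open>Quotient of the normalising constants for the parameters a and b. It is the
    moment itself, because the density with parameters b has mass 1.\<close>
  define c where "c = Gamma A / Gamma (\<Sum>i=1..n. b i) * (\<Prod>i=1..n. Gamma (b i) / Gamma (a i))"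
  have sum_b: "(\<Sum>i=1..n. b i) = A + (\<Sum>i\<in>I. s i)"
    using assms(1) by (simp add: b_def A_def sum.distrib S_def sum.inter_restrict[symmetric] Int_absorb1)
  have "0 < (\<Sum>i=1..n. b i)"
    using n_pos b_pos by (intro sum_pos) auto
  have "0 \<le> c"
    unfolding c_def using A_pos \<open>0 < sum b _\<close> a_pos b_pos
    by (intro mult_nonneg_nonneg prod_nonneg divide_nonneg_nonneg) (auto intro!: less_imp_le[OF Gamma_real_pos])
  have density: "dirichlet_density n a y * (\<Prod>i=1..n. y i powr S i) = c * dirichlet_density n b y" for y
  proof (cases "\<forall>i\<in>{1..n}. 0 < y i")
    case True
    have "(\<Prod>i=1..n. y i powr (a i - 1)) * (\<Prod>i=1..n. y i powr S i) = (\<Prod>i=1..n. y i powr (b i - 1))"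
      using True by (simp add: b_def powr_add[symmetric] prod.distrib[symmetric] algebra_simps)
    moreover have "Gamma (\<Sum>i=1..n. b i) \<noteq> 0"
      using Gamma_real_pos[OF \<open>0 < sum b _\<close>] by simp
    moreover have "\<forall>i\<in>{1..n}. Gamma (b i) \<noteq> 0"
      by (metis Gamma_real_pos b_pos less_irrefl)
    ultimately show ?thesis
      using True by (simp add: dirichlet_density_def c_def A_def prod_dividef mult.assoc)
  qed (auto simp: dirichlet_density_def)
  have "(\<integral>\<^sup>+ \<omega>. ennreal (\<Prod>i=1..n. w \<omega> i powr S i) \<partial>M)
      = (\<integral>\<^sup>+ x. ennreal (dirichlet_density n a (simplex_point n x)) * ennreal (\<Prod>i=1..n. simplex_point n x i powr S i)
           \<partial>(\<Pi>\<^sub>M i\<in>{1..<n}. lborel))"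
    by (rule nn_integral_w) measurable
  also have "\<dots> = (\<integral>\<^sup>+ x. ennreal c * ennreal (dirichlet_density n b (simplex_point n x)) \<partial>(\<Pi>\<^sub>M i\<in>{1..<n}. lborel))"
    using \<open>0 \<le> c\<close> by (simp only: ennreal_mult''[symmetric] ennreal_mult'[symmetric] prod_nonneg powr_ge_zero density)
  also have "\<dots> = ennreal c"
    using n_pos b_pos
    by (subst nn_integral_cmult, measurable, subst nn_integral_dirichlet_density_simplex_point) auto
  finally have "(\<integral>\<^sup>+ \<omega>. ennreal (\<Prod>i=1..n. w \<omega> i powr S i) \<partial>M) = ennreal c" .
  then have "expectation (\<lambda>\<omega>. \<Prod>i=1..n. w \<omega> i powr S i) = c"
    using \<open>0 \<le> c\<close> by (subst integral_eq_nn_integral) (auto intro!: prod_nonneg)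
  moreover have "expectation (\<lambda>\<omega>. \<Prod>i\<in>I. w \<omega> i powr s i) = expectation (\<lambda>\<omega>. \<Prod>i=1..n. w \<omega> i powr S i)"
  proof (rule integral_cong_AE)
    show "AE \<omega> in M. (\<Prod>i\<in>I. w \<omega> i powr s i) = (\<Prod>i=1..n. w \<omega> i powr S i)"
      using AE_w
    proof eventually_elim
      case (elim \<omega>)
      then have "w \<omega> i powr S i = 1" if "i \<in> {1..n} - I" for i
        using that by (force simp: S_def)
      then show ?case
        using assms(1) by (intro prod.mono_neutral_cong_left) (auto simp: S_def)
    qed
  qed (use assms(1) in \<open>auto intro!: borel_measurable_prod\<close>)
  moreover have "(\<Prod>i=1..n. Gamma (b i) / Gamma (a i)) = (\<Prod>i\<in>I. Gamma (a i + s i) / Gamma (a i))"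
  proof (rule prod.mono_neutral_cong_right)
    show "\<forall>i\<in>{1..n} - I. Gamma (b i) / Gamma (a i) = 1"
    proof
      fix i assume "i \<in> {1..n} - I"
      then show "Gamma (b i) / Gamma (a i) = 1"
        using Gamma_real_pos[OF a_pos[of i]] by (simp add: b_def S_def)
    qed
  qed (use assms(1) in \<open>auto simp: b_def S_def\<close>)
  moreover note sum_b
  ultimately show ?thesis
    by (simp add: c_def)
qed

text \<open>Allows passing between \<open>x\<close> and \<open>x powr 1\<close>,
  \<open>x * x\<close> and \<open>x powr 2\<close> and the like, using such identities for positive
  coordinates only.\<close>

lemma integral_cong_w:
  fixes f g :: "'a \<Rightarrow> real"
  assumes "f \<in> borel_measurable M" "g \<in> borel_measurable M"
    and "\<And>\<omega>. (\<And>i. i \<in> {1..n} \<Longrightarrow> 0 < w \<omega> i) \<Longrightarrow> f \<omega> = g \<omega>"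
  shows "expectation f = expectation g"
  using assms(1,2) by (rule integral_cong_AE) (use AE_w in \<open>eventually_elim, use assms(3) in blast\<close>)

lemma expectation_powr:
  assumes "i \<in> {1..n}" "0 \<le> u"
  shows "expectation (\<lambda>\<omega>. w \<omega> i powr u) = Gamma A / Gamma (a i) * (Gamma (a i + u) / Gamma (A + u))"
  using expectation_prod_powr[of "{i}" "\<lambda>_. u"] assms by simp

lemma expectation_powr_powr:
  assumes "i \<in> {1..n}" "j \<in> {1..n}" "i \<noteq> j" "0 \<le> u" "0 \<le> v"
  shows "expectation (\<lambda>\<omega>. w \<omega> i powr u * w \<omega> j powr v)
    = Gamma A * Gamma (a j + v) / (Gamma (a i) * Gamma (a j)) * (Gamma (a i + u) / Gamma (A + v + u))"
  using expectation_prod_powr[of "{i, j}" "\<lambda>k. if k = i then u else v"] assms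
  by (simp add: add_ac mult_ac)

lemma expectation_powr_ln:
  assumes i: "i \<in> {1..n}" and "0 < u"
  shows "expectation (\<lambda>\<omega>. w \<omega> i powr u * ln (w \<omega> i))
    = Gamma A / Gamma (a i) * (Gamma (a i + u) / Gamma (A + u) * (Digamma (a i + u) - Digamma (A + u)))"
proof -
  have "expectation (\<lambda>\<omega>. w \<omega> i powr u * ln (w \<omega> i) * 1)
    = Gamma A / Gamma (a i) * (Gamma (a i + u) / Gamma (A + u) * (Digamma (a i + u) - Digamma (A + u)))"
  proof (rule expectation_powr_ln_eqI[where C = 1])
    show "expectation (\<lambda>\<omega>. w \<omega> i powr v * 1) = Gamma A / Gamma (a i) * (Gamma (a i + v) / Gamma (A + v))"
      if "0 < v" for v
      using expectation_powr[of i v] i that by simp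
    show "((\<lambda>v. Gamma A / Gamma (a i) * (Gamma (a i + v) / Gamma (A + v))) has_field_derivative
        Gamma A / Gamma (a i) * (Gamma (a i + u) / Gamma (A + u) * (Digamma (a i + u) - Digamma (A + u)))) (at u)"
      using a_pos[OF i] A_pos \<open>0 < u\<close> by (intro DERIV_cmult has_field_derivative_Gamma_ratio) auto
  qed (use AE_w_unit[OF i] borel_measurable_w[OF i] \<open>0 < u\<close> in simp_all)
  then show ?thesis
    by simp
qed

lemma expectation_powr_ln_powr:
  assumes i: "i \<in> {1..n}" and j: "j \<in> {1..n}" and "i \<noteq> j" "0 < u" "0 \<le> v"
  shows "expectation (\<lambda>\<omega>. w \<omega> i powr u * ln (w \<omega> i) * w \<omega> j powr v)
    = Gamma A * Gamma (a j + v) / (Gamma (a i) * Gamma (a j))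
      * (Gamma (a i + u) / Gamma (A + v + u) * (Digamma (a i + u) - Digamma (A + v + u)))"
proof (rule expectation_powr_ln_eqI[where C = 1])
  show "((\<lambda>u. Gamma A * Gamma (a j + v) / (Gamma (a i) * Gamma (a j)) * (Gamma (a i + u) / Gamma (A + v + u)))
      has_field_derivative Gamma A * Gamma (a j + v) / (Gamma (a i) * Gamma (a j))
      * (Gamma (a i + u) / Gamma (A + v + u) * (Digamma (a i + u) - Digamma (A + v + u)))) (at u)"
    using a_pos[OF i] A_pos assms by (intro DERIV_cmult has_field_derivative_Gamma_ratio) auto
  show "AE \<omega> in M. \<bar>w \<omega> j powr v\<bar> \<le> 1"
    using AE_w_unit[OF j] by eventually_elim (use \<open>0 \<le> v\<close> in \<open>auto intro: powr_le1\<close>)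
qed (use assms AE_w_unit[OF i] borel_measurable_w[OF i] borel_measurable_w[OF j] in
    \<open>simp_all add: expectation_powr_powr\<close>)

lemma AE_w_ln_bounded:
  assumes "i \<in> {1..n}"
  shows "AE \<omega> in M. \<bar>w \<omega> i * ln (w \<omega> i)\<bar> \<le> 1"
  using AE_w_unit[OF assms]
proof eventually_elim
  case (elim \<omega>)
  then show ?case
    using powr_mult_abs_ln_le[of 1 1 "w \<omega> i"] by (simp add: abs_mult)
qed

section \<open>Closed forms of the first and second moments, with and without logarithms\<close>

lemma expectation_w:
  assumes i: "i \<in> {1..n}"
  shows "expectation (\<lambda>\<omega>. w \<omega> i) = a i / A"
proof -
  have [measurable]: "(\<lambda>\<omega>. w \<omega> i) \<in> borel_measurable M"
    using i by simp
  have "expectation (\<lambda>\<omega>. w \<omega> i) = expectation (\<lambda>\<omega>. w \<omega> i powr 1)"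
    by (rule integral_cong_w) (use i in \<open>auto simp: less_imp_le\<close>)
  also have "\<dots> = a i / A"
    unfolding expectation_powr[OF i zero_le_one] using a_pos[OF i] A_pos
    by (simp add: Gamma_nonzero_of_pos Gamma_plus_one_of_pos)
  finally show ?thesis .
qed

lemma expectation_w_ln:
  assumes i: "i \<in> {1..n}"
  shows "expectation (\<lambda>\<omega>. w \<omega> i * ln (w \<omega> i)) = a i / A * (Digamma (a i + 1) - Digamma (A + 1))"
proof -
  have [measurable]: "(\<lambda>\<omega>. w \<omega> i) \<in> borel_measurable M"
    using i by simp
  have "expectation (\<lambda>\<omega>. w \<omega> i * ln (w \<omega> i)) = expectation (\<lambda>\<omega>. w \<omega> i powr 1 * ln (w \<omega> i))"
    by (rule integral_cong_w) (use i in \<open>auto simp: less_imp_le\<close>)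
  also have "\<dots> = a i / A * (Digamma (a i + 1) - Digamma (A + 1))"
    unfolding expectation_powr_ln[OF i zero_less_one] using a_pos[OF i] A_pos
    by (simp add: Gamma_nonzero_of_pos Gamma_plus_one_of_pos)
  finally show ?thesis .
qed

lemma expectation_w_square:
  assumes i: "i \<in> {1..n}"
  shows "expectation (\<lambda>\<omega>. w \<omega> i * w \<omega> i) = a i * (a i + 1) / (A * (A + 1))"
proof -
  have [measurable]: "(\<lambda>\<omega>. w \<omega> i) \<in> borel_measurable M"
    using i by simp
  have "expectation (\<lambda>\<omega>. w \<omega> i * w \<omega> i) = expectation (\<lambda>\<omega>. w \<omega> i powr 2)"
    by (rule integral_cong_w) (use i in \<open>auto simp: less_imp_le power2_eq_square\<close>)
  also have "\<dots> = a i * (a i + 1) / (A * (A + 1))"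
    unfolding expectation_powr[OF i zero_le_numeral] using a_pos[OF i] A_pos
    by (simp add: Gamma_nonzero_of_pos Gamma_plus_two_of_pos)
  finally show ?thesis .
qed

lemma expectation_w_mult_w:
  assumes i: "i \<in> {1..n}" and j: "j \<in> {1..n}" and "i \<noteq> j"
  shows "expectation (\<lambda>\<omega>. w \<omega> i * w \<omega> j) = a i * a j / (A * (A + 1))"
proof -
  have [measurable]: "(\<lambda>\<omega>. w \<omega> i) \<in> borel_measurable M" "(\<lambda>\<omega>. w \<omega> j) \<in> borel_measurable M"
    using i j by simp_all
  have "expectation (\<lambda>\<omega>. w \<omega> i * w \<omega> j) = expectation (\<lambda>\<omega>. w \<omega> i powr 1 * w \<omega> j powr 1)"
    by (rule integral_cong_w) (use i j in \<open>auto simp: less_imp_le\<close>)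
  also have "\<dots> = a i * a j / (A * (A + 1))"
    unfolding expectation_powr_powr[OF assms zero_le_one zero_le_one] using a_pos[OF i] a_pos[OF j] A_pos
    by (simp add: Gamma_nonzero_of_pos Gamma_plus_one_of_pos Gamma_plus_two_of_pos add.assoc)
  finally show ?thesis .
qed

lemma expectation_w_ln_mult_self:
  assumes i: "i \<in> {1..n}"
  shows "expectation (\<lambda>\<omega>. w \<omega> i * ln (w \<omega> i) * w \<omega> i)
    = a i * (a i + 1) / (A * (A + 1)) * (Digamma (a i + 2) - Digamma (A + 2))"
proof -
  have [measurable]: "(\<lambda>\<omega>. w \<omega> i) \<in> borel_measurable M"
    using i by simp
  have "expectation (\<lambda>\<omega>. w \<omega> i * ln (w \<omega> i) * w \<omega> i) = expectation (\<lambda>\<omega>. w \<omega> i powr 2 * ln (w \<omega> i))"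
    by (rule integral_cong_w) (use i in \<open>auto simp: less_imp_le power2_eq_square\<close>)
  also have "\<dots> = a i * (a i + 1) / (A * (A + 1)) * (Digamma (a i + 2) - Digamma (A + 2))"
    unfolding expectation_powr_ln[OF i zero_less_numeral] using a_pos[OF i] A_pos
    by (simp add: Gamma_nonzero_of_pos Gamma_plus_two_of_pos)
  finally show ?thesis .
qed

lemma expectation_w_ln_mult_w:
  assumes i: "i \<in> {1..n}" and j: "j \<in> {1..n}" and "i \<noteq> j"
  shows "expectation (\<lambda>\<omega>. w \<omega> i * ln (w \<omega> i) * w \<omega> j)
    = a i * a j / (A * (A + 1)) * (Digamma (a i + 1) - Digamma (A + 2))"
proof -
  have [measurable]: "(\<lambda>\<omega>. w \<omega> i) \<in> borel_measurable M" "(\<lambda>\<omega>. w \<omega> j) \<in> borel_measurable M"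
    using i j by simp_all
  have "expectation (\<lambda>\<omega>. w \<omega> i * ln (w \<omega> i) * w \<omega> j)
      = expectation (\<lambda>\<omega>. w \<omega> i powr 1 * ln (w \<omega> i) * w \<omega> j powr 1)"
    by (rule integral_cong_w) (use i j in \<open>auto simp: less_imp_le\<close>)
  also have "\<dots> = a i * a j / (A * (A + 1)) * (Digamma (a i + 1) - Digamma (A + 2))"
    unfolding expectation_powr_ln_powr[OF assms zero_less_one zero_le_one] using a_pos[OF i] a_pos[OF j] A_pos
    by (simp add: Gamma_nonzero_of_pos Gamma_plus_one_of_pos Gamma_plus_two_of_pos add.assoc)
  finally show ?thesis .
qed

text \<open>One factor \<open>w * ln w\<close> is the bounded Y; the other is differentiated at
  exponent 1. The function to differentiate is the single-logarithm moment at exponent 1 + u, a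
  Gamma quotient times a digamma difference: the product rule squares the difference and adds a
  trigamma difference.\<close>

lemma expectation_w_ln_square:
  assumes i: "i \<in> {1..n}"
  shows "expectation (\<lambda>\<omega>. w \<omega> i * ln (w \<omega> i) * (w \<omega> i * ln (w \<omega> i)))
    = a i * (a i + 1) / (A * (A + 1))
      * (Polygamma 1 (a i + 2) - Polygamma 1 (A + 2) + (Digamma (a i + 2) - Digamma (A + 2))\<^sup>2)"
proof -
  have [measurable]: "(\<lambda>\<omega>. w \<omega> i) \<in> borel_measurable M"
    using i by simp
  define F where "F u = Gamma A / Gamma (a i) * (Gamma (a i + 1 + u) / Gamma (A + 1 + u)
    * (Digamma (a i + 1 + u) - Digamma (A + 1 + u)))" for u
  define D where "D = Gamma A / Gamma (a i) * (Gamma (a i + 2) / Gamma (A + 2)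
    * (Polygamma 1 (a i + 2) - Polygamma 1 (A + 2) + (Digamma (a i + 2) - Digamma (A + 2))\<^sup>2))"
  have "expectation (\<lambda>\<omega>. w \<omega> i * ln (w \<omega> i) * (w \<omega> i * ln (w \<omega> i)))
      = expectation (\<lambda>\<omega>. w \<omega> i powr 1 * ln (w \<omega> i) * (w \<omega> i * ln (w \<omega> i)))"
    by (rule integral_cong_w) (use i in \<open>auto simp: less_imp_le\<close>)
  also have "\<dots> = D"
  proof (rule expectation_powr_ln_eqI[where F = F])
    show "expectation (\<lambda>\<omega>. w \<omega> i powr u * (w \<omega> i * ln (w \<omega> i))) = F u" if "0 < u" for u
    proof -
      have "expectation (\<lambda>\<omega>. w \<omega> i powr u * (w \<omega> i * ln (w \<omega> i)))
          = expectation (\<lambda>\<omega>. w \<omega> i powr (1 + u) * ln (w \<omega> i))"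
        by (rule integral_cong_w) (use i in \<open>auto simp: less_imp_le powr_add\<close>)
      then show ?thesis
        using that i by (simp add: expectation_powr_ln F_def add.assoc)
    qed
    have "((\<lambda>u. Digamma (a i + 1 + u) - Digamma (A + 1 + u)) has_field_derivative
        Polygamma 1 (a i + 2) - Polygamma 1 (A + 2)) (at 1)"
      using a_pos[OF i] A_pos
      by (auto intro!: derivative_eq_intros not_nonpos_Ints_of_pos simp: add.assoc)
    from DERIV_cmult[OF DERIV_mult[OF has_field_derivative_Gamma_ratio[of "a i + 1" 1 "A + 1"] this],
        of "Gamma A / Gamma (a i)"]
    show "(F has_field_derivative D) (at 1)"
      using a_pos[OF i] A_pos unfolding F_def[abs_def] D_def
      by (simp add: power2_eq_square algebra_simps diff_divide_distrib add_divide_distrib)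
  qed (use AE_w_unit[OF i] AE_w_ln_bounded[OF i] in simp_all)
  also have "D = a i * (a i + 1) / (A * (A + 1))
      * (Polygamma 1 (a i + 2) - Polygamma 1 (A + 2) + (Digamma (a i + 2) - Digamma (A + 2))\<^sup>2)"
    using a_pos[OF i] A_pos
    by (simp add: D_def Gamma_nonzero_of_pos Gamma_plus_two_of_pos)
  finally show ?thesis .
qed

text \<open>Here the exponent v of coordinate j moves and \<open>w i * ln (w i)\<close> is the
  bounded Y. In the digamma difference of coordinate i only the total \<open>A + 1 + v\<close>
  depends on v, which is why trigamma occurs at \<open>A + 2\<close> alone. K collects the Gamma
  factors free of v.\<close>

lemma expectation_w_ln_mult_w_ln:
  assumes i: "i \<in> {1..n}" and j: "j \<in> {1..n}" and "i \<noteq> j"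
  shows "expectation (\<lambda>\<omega>. w \<omega> i * ln (w \<omega> i) * (w \<omega> j * ln (w \<omega> j)))
    = a i * a j / (A * (A + 1))
      * ((Digamma (a i + 1) - Digamma (A + 2)) * (Digamma (a j + 1) - Digamma (A + 2)) - Polygamma 1 (A + 2))"
proof -
  have [measurable]: "(\<lambda>\<omega>. w \<omega> i) \<in> borel_measurable M" "(\<lambda>\<omega>. w \<omega> j) \<in> borel_measurable M"
    using i j by simp_all
  define K where "K = Gamma A * Gamma (a i + 1) / (Gamma (a i) * Gamma (a j))"
  define F where "F v = K * (Gamma (a j + v) / Gamma (A + 1 + v) * (Digamma (a i + 1) - Digamma (A + 1 + v)))" for v
  define D where "D = K * (Gamma (a j + 1) / Gamma (A + 2)
    * ((Digamma (a i + 1) - Digamma (A + 2)) * (Digamma (a j + 1) - Digamma (A + 2)) - Polygamma 1 (A + 2)))"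
  have "expectation (\<lambda>\<omega>. w \<omega> i * ln (w \<omega> i) * (w \<omega> j * ln (w \<omega> j)))
      = expectation (\<lambda>\<omega>. w \<omega> j powr 1 * ln (w \<omega> j) * (w \<omega> i * ln (w \<omega> i)))"
    by (rule integral_cong_w) (use i j in \<open>auto simp: less_imp_le\<close>)
  also have "\<dots> = D"
  proof (rule expectation_powr_ln_eqI[where F = F])
    show "expectation (\<lambda>\<omega>. w \<omega> j powr v * (w \<omega> i * ln (w \<omega> i))) = F v" if "0 < v" for v
    proof -
      have "expectation (\<lambda>\<omega>. w \<omega> j powr v * (w \<omega> i * ln (w \<omega> i)))
          = expectation (\<lambda>\<omega>. w \<omega> i powr 1 * ln (w \<omega> i) * w \<omega> j powr v)"
        by (rule integral_cong_w) (use i j in \<open>auto simp: less_imp_le\<close>)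
      then show ?thesis
        using expectation_powr_ln_powr[OF assms zero_less_one less_imp_le[OF that]]
        by (simp add: F_def K_def add_ac mult_ac)
    qed
    have "((\<lambda>v. Digamma (a i + 1) - Digamma (A + 1 + v)) has_field_derivative - Polygamma 1 (A + 2)) (at 1)"
      using A_pos by (auto intro!: derivative_eq_intros not_nonpos_Ints_of_pos simp: add.assoc)
    from DERIV_cmult[OF DERIV_mult[OF has_field_derivative_Gamma_ratio[of "a j" 1 "A + 1"] this], of K]
    show "(F has_field_derivative D) (at 1)"
      using a_pos[OF j] A_pos unfolding F_def[abs_def] D_def
      by (simp add: algebra_simps diff_divide_distrib add_divide_distrib)
  qed (use AE_w_unit[OF j] AE_w_ln_bounded[OF i] in simp_all)
  also have "D = a i * a j / (A * (A + 1))
      * ((Digamma (a i + 1) - Digamma (A + 2)) * (Digamma (a j + 1) - Digamma (A + 2)) - Polygamma 1 (A + 2))"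
    using a_pos[OF i] a_pos[OF j] A_pos
    by (simp add: D_def K_def Gamma_nonzero_of_pos Gamma_plus_one_of_pos Gamma_plus_two_of_pos)
  finally show ?thesis .
qed

section \<open>Integrability and covariances of the coordinates\<close>

lemma AE_w_bounded:
  assumes "i \<in> {1..n}"
  shows "AE \<omega> in M. \<bar>w \<omega> i\<bar> \<le> 1"
  using AE_w_unit[OF assms] by eventually_elim simp

lemma borel_measurable_w_ln:
  assumes "i \<in> {1..n}"
  shows "(\<lambda>\<omega>. w \<omega> i * ln (w \<omega> i)) \<in> borel_measurable M"
  using borel_measurable_w[OF assms] by simp

lemma integrable_moments:
  assumes "i \<in> {1..n}" "j \<in> {1..n}"
  shows "integrable M (\<lambda>\<omega>. w \<omega> i)"
    and "integrable M (\<lambda>\<omega>. w \<omega> i * ln (w \<omega> i))"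
    and "integrable M (\<lambda>\<omega>. w \<omega> i * w \<omega> j)"
    and "integrable M (\<lambda>\<omega>. w \<omega> i * ln (w \<omega> i) * w \<omega> j)"
    and "integrable M (\<lambda>\<omega>. w \<omega> i * (w \<omega> j * ln (w \<omega> j)))"
    and "integrable M (\<lambda>\<omega>. w \<omega> i * ln (w \<omega> i) * (w \<omega> j * ln (w \<omega> j)))"
proof -
  note w = borel_measurable_w[OF assms(1)] borel_measurable_w[OF assms(2)]
  note L = borel_measurable_w_ln[OF assms(1)] borel_measurable_w_ln[OF assms(2)]
  note w_bound = AE_w_bounded[OF assms(1)] AE_w_bounded[OF assms(2)]
  note L_bound = AE_w_ln_bounded[OF assms(1)] AE_w_ln_bounded[OF assms(2)]
  show "integrable M (\<lambda>\<omega>. w \<omega> i)" "integrable M (\<lambda>\<omega>. w \<omega> i * ln (w \<omega> i))"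
    by (fact integrable_of_abs_le_one[OF w(1) w_bound(1)] integrable_of_abs_le_one[OF L(1) L_bound(1)])+
  show "integrable M (\<lambda>\<omega>. w \<omega> i * w \<omega> j)"
    by (fact integrable_mult_of_abs_le_one[OF w w_bound])
  show "integrable M (\<lambda>\<omega>. w \<omega> i * ln (w \<omega> i) * w \<omega> j)"
    by (fact integrable_mult_of_abs_le_one[OF L(1) w(2) L_bound(1) w_bound(2)])
  show "integrable M (\<lambda>\<omega>. w \<omega> i * (w \<omega> j * ln (w \<omega> j)))"
    by (fact integrable_mult_of_abs_le_one[OF w(1) L(2) w_bound(1) L_bound(2)])
  show "integrable M (\<lambda>\<omega>. w \<omega> i * ln (w \<omega> i) * (w \<omega> j * ln (w \<omega> j)))"
    by (fact integrable_mult_of_abs_le_one[OF L L_bound])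
qed

lemma covariance_w:
  assumes "i \<in> {1..n}" "j \<in> {1..n}"
  shows "covariance M (\<lambda>\<omega>. w \<omega> i) (\<lambda>\<omega>. w \<omega> j)
      = expectation (\<lambda>\<omega>. w \<omega> i * w \<omega> j) - expectation (\<lambda>\<omega>. w \<omega> i) * expectation (\<lambda>\<omega>. w \<omega> j)"
    and "covariance M (\<lambda>\<omega>. w \<omega> i * ln (w \<omega> i)) (\<lambda>\<omega>. w \<omega> j)
      = expectation (\<lambda>\<omega>. w \<omega> i * ln (w \<omega> i) * w \<omega> j)
        - expectation (\<lambda>\<omega>. w \<omega> i * ln (w \<omega> i)) * expectation (\<lambda>\<omega>. w \<omega> j)"
    and "covariance M (\<lambda>\<omega>. w \<omega> i * ln (w \<omega> i)) (\<lambda>\<omega>. w \<omega> j * ln (w \<omega> j))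
      = expectation (\<lambda>\<omega>. w \<omega> i * ln (w \<omega> i) * (w \<omega> j * ln (w \<omega> j)))
        - expectation (\<lambda>\<omega>. w \<omega> i * ln (w \<omega> i)) * expectation (\<lambda>\<omega>. w \<omega> j * ln (w \<omega> j))"
  using integrable_moments[OF assms] integrable_moments[OF assms(2,1)] by (auto intro!: covariance_eq)

end

section \<open>Mean and variance of the divergence\<close>

text \<open>Each pair i < j stands for the ordered pairs (i, j) and (j, i). Since
  \<open>covariance M (L i) (W j)\<close> is not symmetric in i and j, both mixed terms appear and
  cannot in general be merged into twice one of them. Integrability is asserted as well, because the
  integral of a non-integrable function is 0 by convention and the equations alone would not show
  that the moments exist. Injectivity of \<open>\<xi>\<close> keeps atoms from merging, which would
  add their weights.\<close>

theorem proposition6: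
  fixes M :: "'a measure" and n :: nat and p :: "nat \<Rightarrow> real" and \<alpha> :: real
    and \<xi> :: "nat \<Rightarrow> 'b" and w :: "'a \<Rightarrow> nat \<Rightarrow> real"
  defines "KL \<equiv> \<lambda>\<omega>. KL_discrete (discrete_density n (w \<omega>) \<xi>) (discrete_density n p \<xi>)"
    and "W \<equiv> \<lambda>i \<omega>. w \<omega> i"
    and "L \<equiv> \<lambda>i \<omega>. w \<omega> i * ln (w \<omega> i)"
  assumes "prob_space M"
    and "\<And>i. i \<in> {1..n} \<Longrightarrow> p i > 0"
    and "(\<Sum>i=1..n. p i) = 1"
    and "\<alpha> > 0"
    and "inj_on \<xi> {1..n}"
    and "w \<in> M \<rightarrow>\<^sub>M (\<Pi>\<^sub>M i\<in>{1..n}. borel)"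
    and "distr M (\<Pi>\<^sub>M i\<in>{1..n}. borel) w = dirichlet n (\<lambda>i. \<alpha> * p i)"
  shows "(AE \<omega> in M. KL \<omega> = (\<Sum>i=1..n. w \<omega> i * ln (w \<omega> i / p i))) \<and>
         integrable M KL \<and>
         integrable M (\<lambda>\<omega>. (KL \<omega>)\<^sup>2) \<and>
         prob_space.expectation M KL =
           (\<Sum>i=1..n. p i * (Digamma (\<alpha> * p i + 1) - Digamma (\<alpha> + 1))) - (\<Sum>i=1..n. p i * ln (p i)) \<and>
         prob_space.variance M KL =
           (\<Sum>i=1..n. prob_space.variance M (L i) + (ln (p i))\<^sup>2 * prob_space.variance M (W i)
                     - 2 * ln (p i) * covariance M (L i) (W i))
           + 2 * (\<Sum>i=1..n. \<Sum>j=i+1..n.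
                     covariance M (L i) (L j) + ln (p i) * ln (p j) * covariance M (W i) (W j)
                     - ln (p j) * covariance M (L i) (W j) - ln (p i) * covariance M (L j) (W i)) \<and>
         (\<forall>i\<in>{1..n}. integrable M (\<lambda>\<omega>. (W i \<omega>)\<^sup>2)) \<and>
         (\<forall>i\<in>{1..n}. integrable M (\<lambda>\<omega>. (L i \<omega>)\<^sup>2)) \<and>
         (\<forall>i\<in>{1..n}. prob_space.variance M (W i) = p i * (1 - p i) / (\<alpha> + 1)) \<and>
         (\<forall>i\<in>{1..n}. \<forall>j\<in>{1..n}. j \<noteq> i \<longrightarrow>
           covariance M (W i) (W j) = - (p i * p j / (\<alpha> + 1))) \<and>
         (\<forall>i\<in>{1..n}. prob_space.variance M (L i) =
           p i * (\<alpha> * p i + 1) / (\<alpha> + 1)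
             * (Polygamma 1 (\<alpha> * p i + 2) - Polygamma 1 (\<alpha> + 2)
                + (Digamma (\<alpha> * p i + 2) - Digamma (\<alpha> + 2))\<^sup>2)
           - (p i)\<^sup>2 * (Digamma (\<alpha> * p i + 1) - Digamma (\<alpha> + 1))\<^sup>2) \<and>
         (\<forall>i\<in>{1..n}. covariance M (L i) (W i) =
           p i * (\<alpha> * p i + 1) / (\<alpha> + 1) * (Digamma (\<alpha> * p i + 2) - Digamma (\<alpha> + 2))
           - (p i)\<^sup>2 * (Digamma (\<alpha> * p i + 1) - Digamma (\<alpha> + 1))) \<and>
         (\<forall>i\<in>{1..n}. \<forall>j\<in>{1..n}. j \<noteq> i \<longrightarrow> covariance M (L i) (W j) =
           p i * p j * (- (Digamma (\<alpha> * p i + 1) / (\<alpha> + 1)) + Digamma (\<alpha> + 1)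
                        - \<alpha> * Digamma (\<alpha> + 2) / (\<alpha> + 1))) \<and>
         (\<forall>i\<in>{1..n}. \<forall>j\<in>{1..n}. j \<noteq> i \<longrightarrow> covariance M (L i) (L j) =
           \<alpha> * p i * p j / (\<alpha> + 1)
             * ((Digamma (\<alpha> * p i + 1) - Digamma (\<alpha> + 2))
                  * (Digamma (\<alpha> * p j + 1) - Digamma (\<alpha> + 2)) - Polygamma 1 (\<alpha> + 2))
           - p i * p j * (Digamma (\<alpha> * p i + 1) - Digamma (\<alpha> + 1))
               * (Digamma (\<alpha> * p j + 1) - Digamma (\<alpha> + 1)))"
proof -
  have p: "\<And>i. i \<in> {1..n} \<Longrightarrow> 0 < p i" and sum_p: "(\<Sum>i=1..n. p i) = 1" and "0 < \<alpha>"
    by fact+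
  have "1 \<le> n"
    using sum_p by (cases n) auto
  interpret dirichlet_random_vector M n "\<lambda>i. \<alpha> * p i" w
    using \<open>prob_space M\<close> \<open>1 \<le> n\<close> p \<open>0 < \<alpha>\<close> assms(9,10)
    by (simp add: dirichlet_random_vector_def dirichlet_random_vector_axioms_def)
  have A: "A = \<alpha>"
    using sum_p by (simp add: A_def flip: sum_distrib_left)
  \<comment> \<open>For a positive weight this is the summand \<open>w i * ln (w i / p i)\<close>,
    split into variables with known covariances.\<close>
  define X where "X i \<omega> = L i \<omega> - ln (p i) * W i \<omega>" for i \<omega>
  have KL_eq: "KL \<omega> = (\<Sum>i=1..n. max 0 (w \<omega> i) * ln (max 0 (w \<omega> i) / p i))" for \<omega>
    unfolding KL_def using \<open>inj_on \<xi> {1..n}\<close> p by (rule KL_discrete_discrete_density)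
  have KL_measurable: "KL \<in> borel_measurable M"
    unfolding KL_eq[abs_def] using borel_measurable_w by (intro borel_measurable_sum) simp
  have KL_AE: "AE \<omega> in M. KL \<omega> = (\<Sum>i=1..n. w \<omega> i * ln (w \<omega> i / p i))"
    using AE_w
  proof eventually_elim
    case (elim \<omega>)
    then show ?case
      unfolding KL_eq by (intro sum.cong refl) (simp add: less_imp_le max_absorb2)
  qed
  have KL_X: "AE \<omega> in M. KL \<omega> = (\<Sum>i=1..n. X i \<omega>)"
    using KL_AE AE_w
  proof eventually_elim
    case (elim \<omega>)
    have "w \<omega> i * ln (w \<omega> i / p i) = X i \<omega>" if "i \<in> {1..n}" for i
    proof -
      have "0 < w \<omega> i"
        using elim that by auto
      then show ?thesis
        using p[OF that] by (simp add: X_def L_def W_def ln_div algebra_simps)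
    qed
    then show ?case
      using elim by simp
  qed
  have int: "integrable M (W i)" "integrable M (L i)"
    "integrable M (\<lambda>\<omega>. W i \<omega> * W j \<omega>)" "integrable M (\<lambda>\<omega>. L i \<omega> * W j \<omega>)"
    "integrable M (\<lambda>\<omega>. W i \<omega> * L j \<omega>)" "integrable M (\<lambda>\<omega>. L i \<omega> * L j \<omega>)"
    if "i \<in> {1..n}" "j \<in> {1..n}" for i j
    unfolding W_def L_def using that by (rule integrable_moments)+
  have int_X: "integrable M (X i)" if "i \<in> {1..n}" for i
    unfolding X_def using int[OF that that] by simp
  have int_X_X: "integrable M (\<lambda>\<omega>. X i \<omega> * X j \<omega>)" if "i \<in> {1..n}" "j \<in> {1..n}" for i j
  proof -
    have "(\<lambda>\<omega>. X i \<omega> * X j \<omega>) = (\<lambda>\<omega>. L i \<omega> * L j \<omega> - ln (p j) * (L i \<omega> * W j \<omega>)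
        - ln (p i) * (W i \<omega> * L j \<omega>) + ln (p i) * ln (p j) * (W i \<omega> * W j \<omega>))"
      by (auto simp: X_def algebra_simps)
    then show ?thesis
      using int[OF that] by simp
  qed
  have sum_X_measurable: "(\<lambda>\<omega>. \<Sum>i=1..n. X i \<omega>) \<in> borel_measurable M"
    using int_X by (intro borel_measurable_sum) auto
  have KL_integral: "expectation KL = expectation (\<lambda>\<omega>. \<Sum>i=1..n. X i \<omega>)"
    using KL_measurable sum_X_measurable KL_X by (rule integral_cong_AE)
  have KL_integrable: "integrable M KL"
    using int_X by (subst integrable_cong_AE[OF KL_measurable sum_X_measurable KL_X]) auto
  have KL_square_integrable: "integrable M (\<lambda>\<omega>. (KL \<omega>)\<^sup>2)"
  proof (subst integrable_cong_AE)
    show "AE \<omega> in M. (KL \<omega>)\<^sup>2 = (\<Sum>i=1..n. \<Sum>j=1..n. X i \<omega> * X j \<omega>)"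
      using KL_X by eventually_elim (simp add: power2_eq_square sum_product)
    show "integrable M (\<lambda>\<omega>. \<Sum>i=1..n. \<Sum>j=1..n. X i \<omega> * X j \<omega>)"
      by (intro Bochner_Integration.integrable_sum int_X_X)
    then show "(\<lambda>\<omega>. \<Sum>i=1..n. \<Sum>j=1..n. X i \<omega> * X j \<omega>) \<in> borel_measurable M"
      by (rule borel_measurable_integrable)
  qed (use KL_measurable in simp)
  have cov_X: "covariance M (X i) (X j) = covariance M (L i) (L j) - ln (p j) * covariance M (L i) (W j)
      - ln (p i) * covariance M (L j) (W i) + ln (p i) * ln (p j) * covariance M (W i) (W j)"
    if "i \<in> {1..n}" "j \<in> {1..n}" for i j
    unfolding X_def covariance_commute[of M "L j" "W i"]
    by (rule covariance_diff_scaled) (use int[OF that] int[OF that(2,1)] in simp_all)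
  have KL_variance: "variance KL =
      (\<Sum>i=1..n. variance (L i) + (ln (p i))\<^sup>2 * variance (W i) - 2 * ln (p i) * covariance M (L i) (W i))
      + 2 * (\<Sum>i=1..n. \<Sum>j=i+1..n.
          covariance M (L i) (L j) + ln (p i) * ln (p j) * covariance M (W i) (W j)
          - ln (p j) * covariance M (L i) (W j) - ln (p i) * covariance M (L j) (W i))"
  proof -
    have "variance KL = variance (\<lambda>\<omega>. \<Sum>i=1..n. X i \<omega>)"
      unfolding KL_integral
    proof (rule integral_cong_AE)
      show "AE \<omega> in M. (KL \<omega> - expectation (\<lambda>\<omega>. \<Sum>i=1..n. X i \<omega>))\<^sup>2
          = ((\<Sum>i=1..n. X i \<omega>) - expectation (\<lambda>\<omega>. \<Sum>i=1..n. X i \<omega>))\<^sup>2"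
        using KL_X by eventually_elim simp
    qed (use KL_measurable sum_X_measurable in \<open>auto intro!: borel_measurable_power borel_measurable_diff\<close>)
    also have "\<dots> = (\<Sum>i=1..n. \<Sum>j=1..n. covariance M (X i) (X j))"
      by (rule variance_sum_eq_covariance) (rule int_X int_X_X; assumption)+
    \<comment> \<open>The covariance of \<open>X i\<close> and \<open>X j\<close> is symmetric in i
      and j although its two mixed terms are not individually; folding to i < j is therefore done
      before \<open>cov_X\<close> expands it.\<close>
    also have "\<dots> = (\<Sum>i=1..n. covariance M (X i) (X i)) + 2 * (\<Sum>i=1..n. \<Sum>j=i+1..n. covariance M (X i) (X j))"
      by (rule sum_symmetric_eq_diagonal_plus_upper) (rule covariance_commute)
    finally show ?thesis
      unfolding variance_eq_covariance
      by (simp add: cov_X power2_eq_square algebra_simps)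
  qed
  have KL_expectation: "expectation KL =
      (\<Sum>i=1..n. p i * (Digamma (\<alpha> * p i + 1) - Digamma (\<alpha> + 1))) - (\<Sum>i=1..n. p i * ln (p i))"
  proof -
    have "expectation (X i) = p i * (Digamma (\<alpha> * p i + 1) - Digamma (\<alpha> + 1)) - p i * ln (p i)"
      if "i \<in> {1..n}" for i
      unfolding X_def using int[OF that that] expectation_w[OF that] expectation_w_ln[OF that] \<open>0 < \<alpha>\<close>
      by (simp add: A W_def L_def)
    then show ?thesis
      unfolding KL_integral using int_X by (simp add: sum_subtractf)
  qed
  have mean: "expectation (\<lambda>\<omega>. w \<omega> i) = p i"
      "expectation (\<lambda>\<omega>. w \<omega> i * ln (w \<omega> i)) = p i * (Digamma (\<alpha> * p i + 1) - Digamma (\<alpha> + 1))"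
    if "i \<in> {1..n}" for i
    using expectation_w[OF that] expectation_w_ln[OF that] \<open>0 < \<alpha>\<close> by (simp_all add: A)
  \<comment> \<open>With parameters \<open>\<alpha> * p i\<close> and total \<open>\<alpha>\<close>,
    one factor \<open>\<alpha>\<close> cancels in every second moment.\<close>
  have factor_same: "\<alpha> * q * (\<alpha> * q + 1) / (\<alpha> * (\<alpha> + 1)) = q * (\<alpha> * q + 1) / (\<alpha> + 1)" for q
    using \<open>0 < \<alpha>\<close> by simp
  have factor: "\<alpha> * q * (\<alpha> * r) / (\<alpha> * (\<alpha> + 1)) = \<alpha> * q * r / (\<alpha> + 1)" for q r
    using \<open>0 < \<alpha>\<close> by simp
  have var_W: "variance (W i) = p i * (1 - p i) / (\<alpha> + 1)" if i: "i \<in> {1..n}" for i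
    unfolding variance_eq_covariance
    unfolding W_def covariance_w(1)[OF i i] expectation_w_square[OF i] mean[OF i] A factor_same
    using \<open>0 < \<alpha>\<close> by (simp add: field_simps)
  have cov_W: "covariance M (W i) (W j) = - (p i * p j / (\<alpha> + 1))"
    if i: "i \<in> {1..n}" and j: "j \<in> {1..n}" and "j \<noteq> i" for i j
    unfolding W_def covariance_w(1)[OF i j] expectation_w_mult_w[OF i j \<open>j \<noteq> i\<close>[symmetric]] mean[OF i] mean[OF j] A factor
    using \<open>0 < \<alpha>\<close> by (simp add: field_simps)
  have var_L: "variance (L i) = p i * (\<alpha> * p i + 1) / (\<alpha> + 1)
        * (Polygamma 1 (\<alpha> * p i + 2) - Polygamma 1 (\<alpha> + 2) + (Digamma (\<alpha> * p i + 2) - Digamma (\<alpha> + 2))\<^sup>2)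
      - (p i)\<^sup>2 * (Digamma (\<alpha> * p i + 1) - Digamma (\<alpha> + 1))\<^sup>2" if i: "i \<in> {1..n}" for i
    unfolding variance_eq_covariance
    unfolding L_def covariance_w(3)[OF i i] expectation_w_ln_square[OF i] mean[OF i] A factor_same
    by (simp add: power2_eq_square mult_ac)
  have cov_L_W_same: "covariance M (L i) (W i) =
      p i * (\<alpha> * p i + 1) / (\<alpha> + 1) * (Digamma (\<alpha> * p i + 2) - Digamma (\<alpha> + 2))
      - (p i)\<^sup>2 * (Digamma (\<alpha> * p i + 1) - Digamma (\<alpha> + 1))" if i: "i \<in> {1..n}" for i
    unfolding L_def W_def covariance_w(2)[OF i i] expectation_w_ln_mult_self[OF i] mean[OF i] A factor_same
    by (simp add: power2_eq_square mult_ac)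
  have cov_L_W: "covariance M (L i) (W j) = p i * p j
      * (- (Digamma (\<alpha> * p i + 1) / (\<alpha> + 1)) + Digamma (\<alpha> + 1) - \<alpha> * Digamma (\<alpha> + 2) / (\<alpha> + 1))"
    if i: "i \<in> {1..n}" and j: "j \<in> {1..n}" and "j \<noteq> i" for i j
    unfolding L_def W_def covariance_w(2)[OF i j] expectation_w_ln_mult_w[OF i j \<open>j \<noteq> i\<close>[symmetric]] mean[OF i] mean[OF j] A factor
  proof -
    \<comment> \<open>After this split the full digamma term of coordinate i cancels against the
      product of the means, leaving only its share over \<open>\<alpha> + 1\<close>.\<close>
    have split: "\<alpha> * c / (\<alpha> + 1) = c - c / (\<alpha> + 1)" for c
      using \<open>0 < \<alpha>\<close> by (simp add: field_simps)
    show "\<alpha> * p i * p j / (\<alpha> + 1) * (Digamma (\<alpha> * p i + 1) - Digamma (\<alpha> + 2))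
        - p i * (Digamma (\<alpha> * p i + 1) - Digamma (\<alpha> + 1)) * p j
      = p i * p j * (- (Digamma (\<alpha> * p i + 1) / (\<alpha> + 1)) + Digamma (\<alpha> + 1) - \<alpha> * Digamma (\<alpha> + 2) / (\<alpha> + 1))"
      unfolding split mult.assoc[of \<alpha>] by (simp add: algebra_simps)
  qed
  have cov_L_L: "covariance M (L i) (L j) = \<alpha> * p i * p j / (\<alpha> + 1)
        * ((Digamma (\<alpha> * p i + 1) - Digamma (\<alpha> + 2)) * (Digamma (\<alpha> * p j + 1) - Digamma (\<alpha> + 2))
           - Polygamma 1 (\<alpha> + 2))
      - p i * p j * (Digamma (\<alpha> * p i + 1) - Digamma (\<alpha> + 1)) * (Digamma (\<alpha> * p j + 1) - Digamma (\<alpha> + 1))"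
    if i: "i \<in> {1..n}" and j: "j \<in> {1..n}" and "j \<noteq> i" for i j
    unfolding L_def covariance_w(3)[OF i j] expectation_w_ln_mult_w_ln[OF i j \<open>j \<noteq> i\<close>[symmetric]] mean[OF i] mean[OF j] A factor
    by (simp add: mult_ac)
  have "integrable M (\<lambda>\<omega>. (W i \<omega>)\<^sup>2)" "integrable M (\<lambda>\<omega>. (L i \<omega>)\<^sup>2)" if "i \<in> {1..n}" for i
    using int[OF that that] by (simp_all add: power2_eq_square)
  with KL_AE KL_integrable KL_square_integrable KL_expectation KL_variance
    var_W cov_W var_L cov_L_W_same cov_L_W cov_L_L
  show ?thesis
    by (intro conjI ballI impI)
qed

end
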